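(* Let $\alpha_j>-1$ for $j=1,2$, $\beta_2>0$, $a_1>0$ and $u>0$. Then $$G^{1,2}_{2,1}\left[\frac{u}{a_1}\,\Big|\,{-\beta_2,\ -1-\alpha_1\atop \alpha_2}\right]=a_1^{\alpha_1+2}\,\Gamma(\alpha_2+\beta_2+1)\,u^{-\alpha_1-2}\int_0^{\infty}v^{\alpha_1+\alpha_2+1}(1+v)^{-(1+\alpha_2+\beta_2)}e^{-a_1v/u}\,dv$$ $$=a_1^{\alpha_1+2}\,\Gamma(\alpha_2+\beta_2+1)\,u^{\alpha_2}\int_0^{\infty}v^{\alpha_1+\alpha_2+1}(1+uv)^{-(1+\alpha_2+\beta_2)}e^{-a_1v}\,dv .$$ If moreover $\beta_2-\alpha_1-1\ne\pm\nu$ for all $\nu=0,1,\dots$, then these also equal $$\Gamma(\alpha_2+\beta_2+1)\Gamma(1+\alpha_1-\beta_2)\left(\frac{a_1}{u}\right)^{1+\beta_2}{}_1F_1\left(1+\alpha_2+\beta_2;\beta_2-\alpha_1;\frac{a_1}{u}\right)$$ $$+\Gamma(2+\alpha_1+\alpha_2)\Gamma(\beta_2-\alpha_1-1)\left(\frac{a_1}{u}\right)^{2+\alpha_1}{}_1F_1\left(2+\alpha_1+\alpha_2;2+\alpha_1-\beta_2;\frac{a_1}{u}\right).$$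
   Context: Meijer G-function: for $z>0$, $$G^{m,n}_{p,q}\left[z\,\Big|\,{a_1,\dots,a_p\atop b_1,\dots,b_q}\right]=\frac1{2\pi i}\int_{\kappa-i\infty}^{\kappa+i\infty}\frac{\prod_{j=1}^m\Gamma(b_j+s)\prod_{j=1}^n\Gamma(1-a_j-s)}{\prod_{j=m+1}^q\Gamma(1-b_j-s)\prod_{j=n+1}^p\Gamma(a_j+s)}\,z^{-s}\,ds$$ (here the $a_j$ are the upper parameters of the general G-function), where the real number $\kappa$ is such that all poles of $\Gamma(b_j+s)$, $j\le m$, lie to the left and all poles of $\Gamma(1-a_j-s)$, $j\le n$, lie to the right of the line $\Re s=\kappa$ (such $\kappa$ exists under the stated hypotheses). In the present case the integrand is $\Gamma(\alpha_2+s)\Gamma(1+\beta_2-s)\Gamma(2+\alpha_1-s)(u/a_1)^{-s}$, with $a_1$ the given positive number. ${}_1F_1$ is the confluent hypergeometric series. *)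

theory Defs
  imports "HOL-Complex_Analysis.Complex_Analysis"
begin

text \<open>
  Parameter lists are indexed from 0, so \<open>as ! j\<close> and \<open>bs ! j\<close> are the parameters usually written
  with index \<open>j + 1\<close>; \<open>p\<close> and \<open>q\<close> are the lengths of the lists.
  Since the library sets \<open>Gamma\<close> to 0 at its poles, dividing by \<open>Gamma\<close> agrees everywhere
  with multiplying by the entire function \<open>1/\<Gamma>\<close>.
\<close>

definition meijer_G_integrand ::
  "nat \<Rightarrow> nat \<Rightarrow> complex list \<Rightarrow> complex list \<Rightarrow> real \<Rightarrow> complex \<Rightarrow> complex" where
  "meijer_G_integrand m n as bs z s =
     ((\<Prod>j<m. Gamma (bs ! j + s)) * (\<Prod>j<n. Gamma (1 - as ! j - s))) /
     ((\<Prod>j=m..<length bs. Gamma (1 - bs ! j - s)) * (\<Prod>j=n..<length as. Gamma (as ! j + s)))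
     * complex_of_real z powr (- s)"

definition meijer_G_separates ::
  "nat \<Rightarrow> nat \<Rightarrow> complex list \<Rightarrow> complex list \<Rightarrow> real \<Rightarrow> bool" where
  "meijer_G_separates m n as bs \<kappa> \<longleftrightarrow>
     (\<forall>j<m. \<forall>s. is_pole (\<lambda>s. Gamma (bs ! j + s)) s \<longrightarrow> Re s < \<kappa>) \<and>
     (\<forall>j<n. \<forall>s. is_pole (\<lambda>s. Gamma (1 - as ! j - s)) s \<longrightarrow> Re s > \<kappa>)"

text \<open>
  \<open>has_meijer_G m n as bs z w\<close>: a separating line exists, and along every separating line
  \<open>Re s = \<kappa>\<close>, parametrised by \<open>s = \<kappa> + \<i> t\<close> with \<open>ds = \<i> dt\<close>, the integral converges and yields
  the value \<open>w\<close>. The gauge integral over the whole line covers conditionally convergent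
  improper integrals.
\<close>

definition has_meijer_G ::
  "nat \<Rightarrow> nat \<Rightarrow> complex list \<Rightarrow> complex list \<Rightarrow> real \<Rightarrow> complex \<Rightarrow> bool" where
  "has_meijer_G m n as bs z w \<longleftrightarrow>
     m \<le> length bs \<and> n \<le> length as \<and> (\<exists>\<kappa>. meijer_G_separates m n as bs \<kappa>) \<and>
     (\<forall>\<kappa>. meijer_G_separates m n as bs \<kappa> \<longrightarrow>
       (\<exists>I. ((\<lambda>t. meijer_G_integrand m n as bs z (Complex \<kappa> t) * \<i>) has_integral I) UNIV \<and>
            w = 1 / (2 * of_real pi * \<i>) * I))"

definition meijer_G ::
  "nat \<Rightarrow> nat \<Rightarrow> complex list \<Rightarrow> complex list \<Rightarrow> real \<Rightarrow> complex" where
  "meijer_G m n as bs z = (THE w. has_meijer_G m n as bs z w)"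

lemma has_meijer_G_unique:
  assumes "has_meijer_G m n as bs z w" "has_meijer_G m n as bs z w'"
  shows "w = w'"
proof -
  obtain \<kappa> where k: "meijer_G_separates m n as bs \<kappa>"
    using assms(1) unfolding has_meijer_G_def by blast
  let ?f = "\<lambda>t. meijer_G_integrand m n as bs z (Complex \<kappa> t) * \<i>"
  obtain I where I: "(?f has_integral I) UNIV" "w = 1 / (2 * of_real pi * \<i>) * I"
    using assms(1) k unfolding has_meijer_G_def by blast
  obtain I' where I': "(?f has_integral I') UNIV" "w' = 1 / (2 * of_real pi * \<i>) * I'"
    using assms(2) k unfolding has_meijer_G_def by blast
  show ?thesis using I I' has_integral_unique by blast
qed

lemma meijer_G_eqI: "has_meijer_G m n as bs z w \<Longrightarrow> meijer_G m n as bs z = w"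
  unfolding meijer_G_def using has_meijer_G_unique by blast

definition hyp_1F1 :: "'a::{banach, real_normed_field} \<Rightarrow> 'a \<Rightarrow> 'a \<Rightarrow> 'a" where
  "hyp_1F1 a b z = eval_fps (fps_hypergeo [a] [b] 1) z"

lemma hyp_1F1_eq_suminf:
  "hyp_1F1 a b z = (\<Sum>k. pochhammer a k / pochhammer b k * z ^ k / fact k)"
  by (simp add: hyp_1F1_def eval_fps_def)

end

theory Submission
  imports Defs "HOL-Probability.Sinc_Integral" "HOL-Real_Asymp.Real_Asymp"
begin

text \<open>
  Write $x = a_1/u$, $a = \alpha_2$, $c = 1 + \beta_2$, $d = 2 + \alpha_1$. The function to be integrated
  along $\Re s = \kappa$ is then
  $F(s) = \Gamma(a+s)\,\Gamma(c-s)\,\Gamma(d-s)\,x^s$ (\<open>Barnes_integrand\<close>), symmetric in $c$ and $d$, and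
  a line is separating exactly if $-a < \kappa < \min(c, d)$.

  \<^bold>\<open>Integral representation.\<close> On such a line all three Gamma arguments have positive real part. The
  first two factors form a Beta integral,
  $\Gamma(a+s)\,\Gamma(c-s) = \Gamma(a+c) \int_0^\infty v^{a+s-1} (1+v)^{-(a+c)}\,dv$
  (\<open>complex_Beta_integral\<close>); after exchanging the integrals the remaining integral over the line is the
  inverse Mellin transform $\frac1{2\pi i}\int \Gamma(d-s)\,(xv)^s\,ds = (xv)^d e^{-xv}$
  (\<open>Gamma_inverse_Mellin\<close>). This gives the first formula (\<open>line_integral_Barnes_integrand\<close>), and the
  substitution $v \mapsto uv$ turns it into the second (\<open>set_integral_rescale_powr\<close>).

  \<^bold>\<open>Hypergeometric formula.\<close> If $c - d$ is not an integer, all poles of $F$ to the right of the line are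
  simple: they are the points $c + k$ and $d + k$. Moving the line to the right by an integer $N$ collects their
  residues, which are the terms of the two confluent hypergeometric series
  (\<open>residue_Barnes_integrand\<close>), and the integral over the moved line tends to 0
  (\<open>line_integral_Barnes_tendsto_0\<close>), because $F(s+1)/F(s)$ is $O(1/N)$ uniformly on $\Re s = \kappa + N$.
  The lines $\Re s = \kappa + N$ must miss the poles; since the value does not depend on
  the separating line, $\kappa$ may be chosen so that neither $\kappa - c$ nor $\kappa - d$ is an integer.
  The inverse Mellin transform is obtained by the same shift, the residues forming the
  exponential series.

  All growth estimates come from the functional equation of $\Gamma$. It bounds $|\Gamma(z)|$ by $C/(\Im z)^2$
  on vertical strips away from the real axis (\<open>norm_Gamma_decay\<close>), so that the line integrals converge
  absolutely and the horizontal sides of the rectangles are negligible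
  (\<open>line_integral_difference_residues\<close>); and it gives the ratios $F(s+1)/F(s)$, whose smallness forces the
  integrals over the moved lines to 0 (\<open>integral_sequence_tendsto_0\<close>).
\<close>

section \<open>The Gamma function on vertical strips\<close>

lemma norm_of_real_powr:
  assumes "x > 0"
  shows "norm (complex_of_real x powr s) = x powr Re s"
  using assms by (simp add: norm_powr_real_powr)

lemma
  assumes "Re z > 0" "c > 0"
  shows set_integrable_Gamma_integrand:
      "set_integrable lborel {0<..} (\<lambda>t. complex_of_real t powr (z - 1) * of_real (exp (- (c * t))))"
    and Gamma_integral_scaled:
      "(LINT t:{0<..}|lborel. complex_of_real t powr (z - 1) * of_real (exp (- (c * t)))) =
         Gamma z * of_real c powr (- z)"
proof -
  let ?g = "\<lambda>c t. complex_of_real t powr (z - 1) * of_real (exp (- (c * t)))"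
  have eq: "?g c t = complex_of_real t powr (z - 1) / of_real (exp (c * t))" for c t
    by (simp add: exp_minus field_simps)
  have int: "set_integrable lborel {0<..} (?g c)" if "c > 0" for c
  proof -
    have "(\<lambda>t. indicat_real {0<..} t *\<^sub>R ?g c t) \<in> borel_measurable lborel"
      by measurable
    thus ?thesis
      using absolutely_integrable_Gamma_integral[OF assms(1) that]
      unfolding set_integrable_def eq[symmetric] by (simp add: integrable_completion)
  qed
  have "(LINT t:{0<..}|lborel. ?g 1 t) = integral {0<..} (?g 1)"
    by (rule set_borel_integral_eq_integral int)+ simp
  also have "(?g 1 has_integral Gamma z) {0<..}"
    using Gamma_integral_complex[OF assms(1)] unfolding eq
    by (subst (asm) has_integral_spike_set_eq[where T = "{0<..}"])
       (auto intro!: empty_imp_negligible negligible_subset[OF negligible_sing[of 0]])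
  hence "integral {0<..} (?g 1) = Gamma z" by (rule integral_unique)
  finally have one: "(LINT t:{0<..}|lborel. ?g 1 t) = Gamma z" .
  show "set_integrable lborel {0<..} (?g c)" using int assms by simp
  have "Gamma z = c *\<^sub>R (LINT t|lborel. indicator {0<..} (c * t) *\<^sub>R ?g 1 (c * t))"
    unfolding one[symmetric] set_lebesgue_integral_def
    using assms(2) by (subst lborel_integral_real_affine[where c = c and t = 0]) auto
  also have "\<dots> = c *\<^sub>R (LINT t|lborel. of_real c powr (z - 1) * (indicator {0<..} t *\<^sub>R ?g c t))"
    using assms(2)
    by (intro arg_cong[where f = "\<lambda>x. c *\<^sub>R x"] Bochner_Integration.integral_cong)
       (auto simp: indicator_def zero_less_mult_iff powr_times_real)
  also have "\<dots> = (c *\<^sub>R of_real c powr (z - 1)) * (LINT t:{0<..}|lborel. ?g c t)"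
    by (simp only: set_lebesgue_integral_def integral_mult_right_zero mult_scaleR_left)
  also have "c *\<^sub>R complex_of_real c powr (z - 1) = of_real c powr z"
    using assms(2) by (simp add: powr_diff scaleR_conv_of_real)
  finally show "(LINT t:{0<..}|lborel. ?g c t) = Gamma z * of_real c powr (- z)"
    using assms(2) by (simp add: powr_minus field_simps)
qed

lemma norm_Gamma_le:
  assumes "Re z > 0"
  shows "norm (Gamma z) \<le> Gamma (Re z)"
proof -
  let ?g = "\<lambda>z t. complex_of_real t powr (z - 1) * of_real (exp (- (1 * t)))"
  have "complex_of_real (LINT t:{0<..}|lborel. norm (?g z t)) =
      (LINT t:{0<..}|lborel. complex_of_real (norm (?g z t)))"
    by (rule set_integral_complex_of_real[symmetric])
  also have "\<dots> = (LINT t:{0<..}|lborel. ?g (of_real (Re z)) t)"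
    by (intro set_lebesgue_integral_cong)
       (auto simp: norm_mult norm_of_real_powr powr_of_real[symmetric])
  also have "\<dots> = Gamma (of_real (Re z))"
    using Gamma_integral_scaled[of "of_real (Re z)" 1] assms by simp
  also have "\<dots> = of_real (Gamma (Re z))" by (rule Gamma_complex_of_real)
  finally have "(LINT t:{0<..}|lborel. norm (?g z t)) = Gamma (Re z)"
    unfolding of_real_eq_iff .
  moreover have "norm (LINT t:{0<..}|lborel. ?g z t) \<le> (LINT t:{0<..}|lborel. norm (?g z t))"
    by (rule set_integral_norm_bound[OF set_integrable_Gamma_integrand]) (use assms in auto)
  moreover have "(LINT t:{0<..}|lborel. ?g z t) = Gamma z"
    using Gamma_integral_scaled[OF assms, of 1] by simp
  ultimately show ?thesis by simp
qed

text \<open>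
  Since $\Gamma(z) = \Gamma(z+n)/(z (z+1) \cdots (z+n-1))$ and every factor of the denominator has modulus at
  least $|\Im z|$, the Gamma function decays along vertical lines faster than any power; the numerator is
  controlled by the real Gamma function on a compact interval. The exponent 2 is enough for absolute
  convergence of line integrals.
\<close>

lemma norm_Gamma_decay:
  obtains C where "C \<ge> 0"
    "\<And>z. a \<le> Re z \<Longrightarrow> Re z \<le> b \<Longrightarrow> \<bar>Im z\<bar> \<ge> 1 \<Longrightarrow> norm (Gamma z) \<le> C / (Im z)\<^sup>2"
proof -
  \<comment> \<open>$n$ moves the strip into the right half-plane and supplies at least two factors.\<close>
  define n where "n = nat \<lceil>\<bar>a\<bar>\<rceil> + 2"
  have n: "a + real n > 0" "n \<ge> 2" unfolding n_def by linarith+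
  have "continuous_on {a + n..b + n} (Gamma :: real \<Rightarrow> real)"
    using n by (intro continuous_on_Gamma) (auto elim!: nonpos_Ints_cases)
  hence "bounded (Gamma ` {a + n..b + n})"
    by (intro compact_imp_bounded compact_continuous_image) auto
  then obtain C where C: "C > 0" "\<And>x. x \<in> {a + n..b + n} \<Longrightarrow> norm (Gamma x) \<le> C"
    by (auto simp: bounded_pos)
  show ?thesis
  proof (rule that)
    show "C \<ge> 0" using C by simp
    fix z assume z: "a \<le> Re z" "Re z \<le> b" "\<bar>Im z\<bar> \<ge> 1"
    have znp: "z \<notin> \<int>\<^sub>\<le>\<^sub>0" using z by (auto elim!: nonpos_Ints_cases)
    have "\<bar>Im z\<bar> ^ 2 \<le> \<bar>Im z\<bar> ^ n" using z n by (intro power_increasing) auto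
    also have "\<dots> = (\<Prod>i<n. \<bar>Im (z + of_nat i)\<bar>)" by simp
    also have "\<dots> \<le> norm (pochhammer z n)"
      unfolding pochhammer_prod prod_norm[symmetric] atLeast0LessThan
      by (intro prod_mono conjI abs_Im_le_cmod) auto
    finally have p: "(Im z)\<^sup>2 \<le> norm (pochhammer z n)" by simp
    have pos: "(Im z)\<^sup>2 > 0" using z by auto
    have "Gamma (z + of_nat n) = pochhammer z n * Gamma z"
      using znp by (simp add: pochhammer_Gamma Gamma_eq_zero_iff)
    hence "norm (pochhammer z n) * norm (Gamma z) = norm (Gamma (z + of_nat n))"
      by (simp add: norm_mult)
    also have "\<dots> \<le> Gamma (Re (z + of_nat n))" using z n by (intro norm_Gamma_le) auto
    also have "\<dots> \<le> C" using C(2)[of "Re z + n"] z by auto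
    finally have "norm (pochhammer z n) * norm (Gamma z) \<le> C" .
    moreover have "(Im z)\<^sup>2 * norm (Gamma z) \<le> norm (pochhammer z n) * norm (Gamma z)"
      using p by (intro mult_right_mono) auto
    ultimately show "norm (Gamma z) \<le> C / (Im z)\<^sup>2"
      using pos by (simp add: field_simps)
  qed
qed

lemma integrable_vertical_line:
  fixes f :: "real \<Rightarrow> complex"
  assumes cont: "continuous_on UNIV f"
    and decay: "\<And>t. \<bar>t\<bar> \<ge> 1 \<Longrightarrow> norm (f t) \<le> C / t\<^sup>2"
  shows "integrable lborel f"
proof -
  have "bounded (f ` {-1..1})"
    by (intro compact_imp_bounded compact_continuous_image continuous_on_subset[OF cont]) auto
  then obtain B where B: "B > 0" "\<And>t. t \<in> {-1..1} \<Longrightarrow> norm (f t) \<le> B"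
    by (auto simp: bounded_pos)
  have C: "C \<ge> 0" using decay[of 1] norm_ge_zero[of "f 1"] by simp (meson order_trans norm_ge_zero)
  have int: "integrable lborel (\<lambda>t::real. 2 * (B + C) * inverse (1 + t\<^sup>2))"
    using integrable_inverse_1_plus_square by (simp add: set_integrable_def)
  show ?thesis
  proof (rule Bochner_Integration.integrable_bound[OF int])
    show "f \<in> borel_measurable lborel"
      using cont by (simp add: borel_measurable_continuous_onI)
    show "AE t in lborel. norm (f t) \<le> norm (2 * (B + C) * inverse (1 + t\<^sup>2))"
    proof (rule AE_I2)
      fix t :: real
      have pos: "1 + t\<^sup>2 > 0" by (simp add: add_pos_nonneg)
      have "norm (f t) \<le> 2 * (B + C) / (1 + t\<^sup>2)"
      proof (cases "\<bar>t\<bar> \<le> 1")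
        case True
        hence "t\<^sup>2 \<le> 1" by (simp add: abs_square_le_1)
        hence "B * (1 + t\<^sup>2) \<le> B * 2" using B by (intro mult_left_mono) auto
        hence "B \<le> 2 * (B + C) / (1 + t\<^sup>2)"
          using pos C by (simp add: field_simps)
        thus ?thesis using B(2)[of t] True by (auto simp: abs_le_iff)
      next
        case False
        hence "t\<^sup>2 \<ge> 1" using one_le_power[of "\<bar>t\<bar>" 2] by simp
        hence "t\<^sup>2 > 0" by linarith
        have "C * (1 + t\<^sup>2) \<le> C * (2 * t\<^sup>2)"
          using C \<open>t\<^sup>2 \<ge> 1\<close> by (intro mult_left_mono) auto
        also have "\<dots> \<le> 2 * (B + C) * t\<^sup>2" using B by (simp add: algebra_simps)
        finally have "C / t\<^sup>2 \<le> 2 * (B + C) / (1 + t\<^sup>2)"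
          by (simp only: pos_le_divide_eq[OF pos] times_divide_eq_left
                pos_divide_le_eq[OF \<open>t\<^sup>2 > 0\<close>])
        thus ?thesis using decay[of t] False by simp
      qed
      thus "norm (f t) \<le> norm (2 * (B + C) * inverse (1 + t\<^sup>2))"
        using B C pos by (simp add: divide_inverse)
    qed
  qed
qed

section \<open>Shifting a vertical line of integration\<close>

text \<open>
  The residue theorem on the rectangle with corners $\kappa - iT$ and $\kappa' + iT$, as $T \to \infty$: the
  decay hypothesis makes the horizontal sides contribute $O(1/T^2)$. The factor $i$ from $ds = i\,dt$ cancels
  against the one in $2 \pi i$, which leaves $2\pi$.
\<close>

lemma line_integral_difference_residues:
  fixes f :: "complex \<Rightarrow> complex"
  assumes order: "a < \<kappa>" "\<kappa> < \<kappa>'" "\<kappa>' < b"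
    and P: "finite P" "\<And>p. p \<in> P \<Longrightarrow> \<kappa> < Re p \<and> Re p < \<kappa>'"
    and holo: "f holomorphic_on {z. a < Re z \<and> Re z < b} - P"
    and decay: "\<And>z. \<kappa> \<le> Re z \<Longrightarrow> Re z \<le> \<kappa>' \<Longrightarrow> \<bar>Im z\<bar> \<ge> 1 \<Longrightarrow> norm (f z) \<le> C / (Im z)\<^sup>2"
  shows "integrable lborel (\<lambda>t. f (Complex \<kappa> t))"
    and "integrable lborel (\<lambda>t. f (Complex \<kappa>' t))"
    and "(LINT t|lborel. f (Complex \<kappa>' t)) - (LINT t|lborel. f (Complex \<kappa> t)) =
           2 * of_real pi * (\<Sum>p\<in>P. residue f p)"
proof -
  define S where "S = {z. a < Re z \<and> Re z < b}"
  have S: "open S" "connected S"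
  proof -
    have *: "S = {z. a < Re z} \<inter> {z. Re z < b}" by (auto simp: S_def)
    show "open S" unfolding * by (intro open_Int open_halfspace_Re_gt open_halfspace_Re_lt)
    show "connected S" unfolding *
      by (intro convex_connected convex_Int convex_halfspace_Re_gt convex_halfspace_Re_lt)
  qed
  have cont: "continuous_on (S - P) f"
    using holo unfolding S_def by (rule holomorphic_on_imp_continuous_on)
  have Complex_eq': "Complex c t = of_real c + \<i> * of_real t" for c t
    by (simp add: complex_eq_iff)
  have line: "integrable lborel (\<lambda>t. f (Complex c t))" if "c \<in> {\<kappa>, \<kappa>'}" for c
  proof (rule integrable_vertical_line)
    show "continuous_on UNIV (\<lambda>t. f (Complex c t))"
      unfolding Complex_eq' using that order P(2)
      by (intro continuous_on_compose2[OF cont] continuous_intros) (fastforce simp: S_def)+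
    show "norm (f (Complex c t)) \<le> C / t\<^sup>2" if "\<bar>t\<bar> \<ge> 1" for t
      using decay[of "Complex c t"] that \<open>c \<in> {\<kappa>, \<kappa>'}\<close> order by auto
  qed
  show int: "integrable lborel (\<lambda>t. f (Complex \<kappa> t))" "integrable lborel (\<lambda>t. f (Complex \<kappa>' t))"
    by (simp_all add: line)
  have C: "C \<ge> 0" using decay[of "Complex \<kappa> 1"] order by (auto intro: order_trans[OF norm_ge_zero])
  \<comment> \<open>The part of the line integral inside the rectangle of height $2T$.\<close>
  define V where "V c T = (LINT t:{-T..T}|lborel. f (Complex c t))" for c T
  have lim: "(\<lambda>n. V c (real n)) \<longlonglongrightarrow> (LINT t|lborel. f (Complex c t))"
    if c: "c \<in> {\<kappa>, \<kappa>'}" for c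
    unfolding V_def set_lebesgue_integral_def
  proof (rule integral_dominated_convergence[where w = "\<lambda>t. norm (f (Complex c t))"])
    show "(\<lambda>t. f (Complex c t)) \<in> borel_measurable lborel"
      using line[OF c] by auto
    thus "(\<lambda>t. indicat_real {- real n..real n} t *\<^sub>R f (Complex c t)) \<in> borel_measurable lborel" for n
      by measurable
    show "AE t in lborel. (\<lambda>n. indicat_real {- real n..real n} t *\<^sub>R f (Complex c t))
            \<longlonglongrightarrow> f (Complex c t)"
    proof (rule AE_I2)
      fix t :: real
      have "eventually (\<lambda>n. indicat_real {- real n..real n} t *\<^sub>R f (Complex c t) = f (Complex c t)) sequentially"
        using eventually_ge_at_top[of "nat \<lceil>\<bar>t\<bar>\<rceil>"]
      proof eventually_elim
        case (elim n)
        hence "\<bar>t\<bar> \<le> real n" by linarith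
        thus ?case by (simp add: indicator_def abs_le_iff)
      qed
      thus "(\<lambda>n. indicat_real {- real n..real n} t *\<^sub>R f (Complex c t)) \<longlonglongrightarrow> f (Complex c t)"
        by (rule tendsto_eventually)
    qed
  qed (use line[OF c] in \<open>auto simp: indicator_def\<close>)
  obtain T0 where T0: "T0 > 0" "\<And>p. p \<in> P \<Longrightarrow> \<bar>Im p\<bar> < T0"
  proof -
    have "finite ((\<lambda>p. \<bar>Im p\<bar>) ` P)" using P by simp
    then obtain B where "\<forall>x\<in>(\<lambda>p. \<bar>Im p\<bar>) ` P. x \<le> B"
      using bdd_above_finite unfolding bdd_above_def by blast
    thus ?thesis by (intro that[of "max B 0 + 1"]) (auto simp: less_eq_real_def intro: le_less_trans)
  qed
  define R where "R = (\<Sum>p\<in>P. residue f p)"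
  have bound: "norm (V \<kappa>' T - V \<kappa> T - 2 * of_real pi * R) \<le> 2 * (C * (\<kappa>' - \<kappa>)) / T\<^sup>2"
    if T: "T \<ge> T0" "T \<ge> 1" for T
  proof -
    define a1 a2 a3 a4 where "a1 = Complex \<kappa> (-T)" and "a2 = Complex \<kappa>' (-T)"
      and "a3 = Complex \<kappa>' T" and "a4 = Complex \<kappa> T"
    have bd: "z \<in> S - P" if "Re z = \<kappa> \<or> Re z = \<kappa>' \<or> (\<bar>Im z\<bar> = T \<and> \<kappa> \<le> Re z \<and> Re z \<le> \<kappa>')" for z
      using that order P(2)[of z] T0(2)[of z] T by (auto simp: S_def)
    have seg: "closed_segment a1 a2 \<subseteq> S - P" "closed_segment a2 a3 \<subseteq> S - P"
      "closed_segment a3 a4 \<subseteq> S - P" "closed_segment a4 a1 \<subseteq> S - P"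
      using order T
      by (auto intro!: bd simp: a1_def a2_def a3_def a4_def closed_segment_same_Re closed_segment_same_Im
            closed_segment_eq_real_ivl split: if_splits)
    have ci: "f contour_integrable_on linepath a1 a2" "f contour_integrable_on linepath a2 a3"
      "f contour_integrable_on linepath a3 a4" "f contour_integrable_on linepath a4 a1"
      by (intro contour_integrable_continuous_linepath continuous_on_subset[OF cont] seg)+
    have rp: "rectpath a1 a3 = linepath a1 a2 +++ linepath a2 a3 +++ linepath a3 a4 +++ linepath a4 a1"
      by (simp add: rectpath_def Let_def a1_def a2_def a3_def a4_def)
    have vert: "contour_integral (linepath (Complex c (-T)) (Complex c T)) f = \<i> * V c T"
      if "c \<in> {\<kappa>, \<kappa>'}" for c
    proof -
      have "set_integrable lborel {-T..T} (\<lambda>t. f (Complex c t))"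
        using line[OF that] unfolding set_integrable_def by (rule integrable_mult_indicator[rotated]) auto
      thus ?thesis unfolding V_def using T
        by (subst contour_integral_linepath_same_Re[where c = c and a = "-T" and b = T])
           (auto simp: set_borel_integral_eq_integral)
    qed
    have "contour_integral (linepath a4 a1) f = - contour_integral (linepath a1 a4) f"
      using seg by (intro contour_integral_reverse_linepath continuous_on_subset[OF cont])
    hence "contour_integral (linepath a4 a1) f = - (\<i> * V \<kappa> T)"
      using vert[of \<kappa>] by (simp add: a1_def a4_def)
    moreover have "contour_integral (linepath a2 a3) f = \<i> * V \<kappa>' T"
      using vert[of \<kappa>'] by (simp add: a2_def a3_def)
    moreover have "contour_integral (rectpath a1 a3) f = 2 * pi * \<i> * (\<Sum>p\<in>P. winding_number (rectpath a1 a3) p * residue f p)"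
    proof (rule Residue_theorem[OF S P(1)])
      show "f holomorphic_on S - P" using holo by (simp add: S_def)
      show "path_image (rectpath a1 a3) \<subseteq> S - P"
        unfolding rp using seg by (simp add: path_image_join)
      show "\<forall>z. z \<notin> S \<longrightarrow> winding_number (rectpath a1 a3) z = 0"
        using order T
        by (auto intro!: winding_number_rectpath_outside simp: a1_def a3_def S_def in_cbox_complex_iff)
    qed auto
    moreover have "(\<Sum>p\<in>P. winding_number (rectpath a1 a3) p * residue f p) = R"
      unfolding R_def
    proof (intro sum.cong refl)
      fix p assume p: "p \<in> P"
      hence "p \<in> box a1 a3"
        using P(2)[OF p] T0(2)[OF p] T by (auto simp: a1_def a3_def in_box_complex_iff)
      thus "winding_number (rectpath a1 a3) p * residue f p = residue f p"
        by (simp add: winding_number_rectpath)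
    qed
    moreover have "contour_integral (rectpath a1 a3) f = contour_integral (linepath a1 a2) f +
        contour_integral (linepath a2 a3) f + contour_integral (linepath a3 a4) f +
        contour_integral (linepath a4 a1) f"
      unfolding rp using ci by (simp add: contour_integral_join contour_integrable_join)
    ultimately have "\<i> * (V \<kappa>' T - V \<kappa> T - 2 * of_real pi * R) =
        - contour_integral (linepath a1 a2) f - contour_integral (linepath a3 a4) f"
      by (simp add: algebra_simps)
    hence "norm (V \<kappa>' T - V \<kappa> T - 2 * of_real pi * R) =
        norm (- contour_integral (linepath a1 a2) f - contour_integral (linepath a3 a4) f)"
      by (metis norm_mult norm_ii mult_1)
    also have "\<dots> \<le> norm (contour_integral (linepath a1 a2) f) + norm (contour_integral (linepath a3 a4) f)"
      by (metis norm_minus_cancel norm_triangle_ineq4)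
    also have "norm (contour_integral (linepath a1 a2) f) \<le> C / T\<^sup>2 * norm (a2 - a1)"
    proof (rule contour_integral_bound_linepath[OF ci(1)])
      show "norm (f z) \<le> C / T\<^sup>2" if "z \<in> closed_segment a1 a2" for z
        using decay[of z] that order T
        by (auto simp: a1_def a2_def closed_segment_same_Im closed_segment_eq_real_ivl)
    qed (use C in auto)
    also have "norm (contour_integral (linepath a3 a4) f) \<le> C / T\<^sup>2 * norm (a4 - a3)"
    proof (rule contour_integral_bound_linepath[OF ci(3)])
      show "norm (f z) \<le> C / T\<^sup>2" if "z \<in> closed_segment a3 a4" for z
        using decay[of z] that order T
        by (auto simp: a3_def a4_def closed_segment_same_Im closed_segment_eq_real_ivl)
    qed (use C in auto)
    finally have "norm (V \<kappa>' T - V \<kappa> T - 2 * of_real pi * R) \<le>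
        C / T\<^sup>2 * norm (a2 - a1) + C / T\<^sup>2 * norm (a4 - a3)" by simp
    moreover have "norm (a2 - a1) = \<kappa>' - \<kappa>" "norm (a4 - a3) = \<kappa>' - \<kappa>"
      using order by (simp_all add: a1_def a2_def a3_def a4_def cmod_def)
    ultimately show ?thesis by (simp add: algebra_simps)
  qed
  have "(\<lambda>n. V \<kappa>' (real n) - V \<kappa> (real n) - 2 * of_real pi * R) \<longlonglongrightarrow> 0"
  proof (rule Lim_null_comparison)
    show "eventually (\<lambda>n. norm (V \<kappa>' (real n) - V \<kappa> (real n) - 2 * of_real pi * R)
            \<le> 2 * (C * (\<kappa>' - \<kappa>)) / (real n)\<^sup>2) sequentially"
      using eventually_ge_at_top[of "nat \<lceil>T0\<rceil> + 1"]
      by eventually_elim (intro bound, linarith+)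
    have "(\<lambda>n. 2 * (C * (\<kappa>' - \<kappa>)) * inverse (real n) ^ 2) \<longlonglongrightarrow> 2 * (C * (\<kappa>' - \<kappa>)) * 0 ^ 2"
      by (intro tendsto_intros lim_inverse_n)
    thus "(\<lambda>n. 2 * (C * (\<kappa>' - \<kappa>)) / (real n)\<^sup>2) \<longlonglongrightarrow> 0"
      by (simp add: field_simps)
  qed
  moreover have "(\<lambda>n. V \<kappa>' (real n) - V \<kappa> (real n) - 2 * of_real pi * R) \<longlonglongrightarrow>
      (LINT t|lborel. f (Complex \<kappa>' t)) - (LINT t|lborel. f (Complex \<kappa> t)) - 2 * of_real pi * R"
    by (intro tendsto_intros lim) auto
  ultimately have "(LINT t|lborel. f (Complex \<kappa>' t)) - (LINT t|lborel. f (Complex \<kappa> t)) - 2 * of_real pi * R = 0"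
    using LIMSEQ_unique by blast
  thus "(LINT t|lborel. f (Complex \<kappa>' t)) - (LINT t|lborel. f (Complex \<kappa> t)) =
           2 * of_real pi * (\<Sum>p\<in>P. residue f p)"
    by (simp add: R_def)
qed

text \<open>
  The sign comes from the reflected argument: $c - s$ runs through the pole $-k$ in the opposite direction to $s$.
\<close>

lemma residue_Gamma_diff_mult:
  assumes "open U" "c + of_nat k \<in> U" "h holomorphic_on U"
  shows "residue (\<lambda>s. Gamma (c - s) * h s) (c + of_nat k) = - ((-1) ^ k / fact k * h (c + of_nat k))"
proof (rule residue_simple')
  let ?p = "c + of_nat k"
  let ?V = "U \<inter> (\<lambda>s. c - s) -` (- (\<int>\<^sub>\<le>\<^sub>0 - {- of_nat k}))"
  have op: "open (- (\<int>\<^sub>\<le>\<^sub>0 - {-of_nat k}) :: complex set)"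
    by (intro open_Compl closed_subset_Ints) auto
  show "open ?V"
    by (intro open_Int assms(1) open_vimage[OF op] continuous_intros)
  show "?p \<in> ?V" using assms by auto
  show "(\<lambda>s. Gamma (c - s) * h s) holomorphic_on ?V - {?p}"
    by (intro holomorphic_intros holomorphic_on_subset[OF assms(3)])
       (auto simp: algebra_simps)
  have "filterlim (\<lambda>s. c - s) (at (- of_nat k)) (at ?p)"
    by (rule filterlim_atI) (auto intro!: tendsto_eq_intros simp: eventually_at_filter algebra_simps)
  hence "((\<lambda>s. Gamma (c - s) * (c - s + of_nat k)) \<longlongrightarrow> (-1) ^ k / fact k) (at ?p)"
    by (rule filterlim_compose[OF Gamma_residues])
  moreover have "isCont h ?p"
    using assms by (meson continuous_on_eq_continuous_at holomorphic_on_imp_continuous_on)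
  ultimately have "((\<lambda>s. - (Gamma (c - s) * (c - s + of_nat k) * h s)) \<longlongrightarrow> - ((-1) ^ k / fact k * h ?p)) (at ?p)"
    unfolding isCont_def by (intro tendsto_intros)
  thus "((\<lambda>s. Gamma (c - s) * h s * (s - ?p)) \<longlongrightarrow> - ((-1) ^ k / fact k * h ?p)) (at ?p)"
    by (rule Lim_transform_eventually) (auto simp: algebra_simps)
qed

text \<open>
  A ratio test for integrals. With $g_n(t) = f(\kappa + n + it)$ and a function $f$ satisfying
  $f(s+1) = q(s) f(s)$, it shows that the line integrals of $f$ vanish in the limit $\Re s \to \infty$ as soon as
  $q \to 0$.
\<close>

lemma integral_sequence_tendsto_0:
  fixes g :: "nat \<Rightarrow> real \<Rightarrow> complex"
  assumes int: "\<And>n. integrable lborel (g n)"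
    and step: "\<And>n t. norm (g (Suc n) t) \<le> r n * norm (g n t)"
    and r: "r \<longlonglongrightarrow> 0"
  shows "(\<lambda>n. LINT t|lborel. g n t) \<longlonglongrightarrow> 0"
proof -
  define a where "a n = (LINT t|lborel. norm (g n t))" for n
  have a_nonneg: "a n \<ge> 0" for n unfolding a_def by (rule integral_nonneg_AE) auto
  have "eventually (\<lambda>n. r n < 1/2) sequentially"
    using r by (rule order_tendstoD) auto
  then obtain N where N: "\<And>n. n \<ge> N \<Longrightarrow> r n < 1/2" by (auto simp: eventually_sequentially)
  have "a (Suc n) \<le> 1/2 * a n" if "n \<ge> N" for n
  proof -
    have "norm (g (Suc n) t) \<le> 1/2 * norm (g n t)" for t
      using step[of n t] mult_right_mono[of "r n" "1/2" "norm (g n t)"] N[OF that] by auto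
    hence "a (Suc n) \<le> (LINT t|lborel. 1/2 * norm (g n t))"
      unfolding a_def by (intro integral_mono integrable_norm int integrable_mult_right) auto
    thus ?thesis by (simp add: a_def)
  qed
  hence "summable a"
    using a_nonneg by (intro summable_ratio_test[of "1/2" N]) auto
  hence "a \<longlonglongrightarrow> 0" by (rule summable_LIMSEQ_zero)
  thus ?thesis
    by (rule Lim_null_comparison[rotated]) (auto simp: a_def intro!: always_eventually integral_norm_bound)
qed

section \<open>The inverse Mellin transform of the Gamma function\<close>

lemma Gamma_diff_plus_one:
  fixes c s :: complex
  assumes "c - s - 1 \<notin> \<int>\<^sub>\<le>\<^sub>0"
  shows "Gamma (c - (s + 1)) = Gamma (c - s) / (c - s - 1)"
proof -
  have "c - s - 1 \<noteq> 0" using assms by (metis zero_in_nonpos_Ints)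
  thus ?thesis using Gamma_plus1[OF assms] by (simp add: diff_diff_eq)
qed

lemma Gamma_reflect_vertical_decay:
  fixes c a b :: real
  obtains C where "C \<ge> 0"
    "\<And>z. a \<le> Re z \<Longrightarrow> Re z \<le> b \<Longrightarrow> \<bar>Im z\<bar> \<ge> 1 \<Longrightarrow> norm (Gamma (of_real c - z)) \<le> C / (Im z)\<^sup>2"
proof -
  obtain C where "C \<ge> 0" and C: "\<And>z. c - b \<le> Re z \<Longrightarrow> Re z \<le> c - a \<Longrightarrow> \<bar>Im z\<bar> \<ge> 1 \<Longrightarrow>
      norm (Gamma z) \<le> C / (Im z)\<^sup>2"
    using norm_Gamma_decay[of "c - b" "c - a"] by blast
  show ?thesis
    by (rule that[OF \<open>C \<ge> 0\<close>], use C[of "of_real c - z" for z] in auto)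
qed

text \<open>
  The maximum of $y^\sigma$ over $a \le \sigma \le b$ is attained at $a$ if $y < 1$ and at $b$ otherwise; the sum covers both cases.
\<close>

lemma powr_strip_bound:
  fixes a b y :: real
  assumes "y > 0" "a \<le> Re z" "Re z \<le> b"
  shows "norm (complex_of_real y powr z) \<le> y powr a + y powr b"
proof -
  have "y powr Re z \<le> y powr a + y powr b"
    using assms powr_mono[of "Re z" b y] powr_mono'[of a "Re z" y]
    by (cases "y \<ge> 1") (auto intro: order_trans add_increasing add_increasing2)
  thus ?thesis using assms by (simp add: norm_of_real_powr)
qed

lemma nonpos_Int_of_real_minus_iff:
  "complex_of_real c - s \<in> \<int>\<^sub>\<le>\<^sub>0 \<longleftrightarrow> (\<exists>k::nat. s = of_real c + of_nat k)"
  by (auto elim!: nonpos_Ints_cases' simp: algebra_simps intro: minus_of_nat_in_nonpos_Ints)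

text \<open>
  Moving the line from $\kappa$ to $c + n + \frac12$ crosses the poles $c, c + 1, \dots, c + n$ of
  $\Gamma(c - s)$, whose residues $-y^c (-y)^k/k!$ add up to a partial sum of $-y^c e^{-y}$.
\<close>

lemma Gamma_inverse_Mellin:
  fixes c \<kappa> y :: real
  assumes "\<kappa> < c" "y > 0"
  shows "(LINT t|lborel. Gamma (of_real c - Complex \<kappa> t) * of_real y powr Complex \<kappa> t) =
           of_real (2 * pi * (y powr c * exp (- y)))"
proof -
  define f where "f s = Gamma (of_real c - s) * complex_of_real y powr s" for s
  define L where "L \<mu> = (LINT t|lborel. f (Complex \<mu> t))" for \<mu>
  define P where "P n = (\<lambda>k. complex_of_real c + of_nat k) ` {..n::nat}" for n
  \<comment> \<open>The offset 1/2 keeps the new line halfway between two poles.\<close>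
  define \<mu> where "\<mu> n = c + real n + 1/2" for n :: nat
  have P_inj: "inj_on (\<lambda>k. complex_of_real c + of_nat k) A" for A by (auto intro: inj_onI)
  have res: "residue f (of_real c + of_nat k) = - (of_real (y powr c) * ((- of_real y) ^ k / fact k))" for k
  proof -
    have "residue f (of_real c + of_nat k) =
        - ((-1) ^ k / fact k * complex_of_real y powr (of_real c + of_nat k))"
      unfolding f_def by (rule residue_Gamma_diff_mult[of UNIV]) (use assms in \<open>auto intro!: holomorphic_intros\<close>)
    also have "complex_of_real y powr (of_real c + of_nat k) = of_real (y powr c) * of_real y ^ k"
      using assms by (simp add: powr_add powr_of_real powr_nat)
    finally show ?thesis by (simp add: power_minus[of "of_real y"])
  qed
  have shift: "integrable lborel (\<lambda>t. f (Complex (\<mu> n) t))"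
    "L (\<mu> n) - L \<kappa> = 2 * of_real pi * (\<Sum>p\<in>P n. residue f p)" for n
  proof -
    obtain C where C: "C \<ge> 0" "\<And>z. \<kappa> \<le> Re z \<Longrightarrow> Re z \<le> \<mu> n \<Longrightarrow> \<bar>Im z\<bar> \<ge> 1 \<Longrightarrow>
        norm (Gamma (of_real c - z)) \<le> C / (Im z)\<^sup>2"
      using Gamma_reflect_vertical_decay[of \<kappa> "\<mu> n" c] by blast
    have 1: "norm (f z) \<le> C * (y powr \<kappa> + y powr \<mu> n) / (Im z)\<^sup>2"
      if z: "\<kappa> \<le> Re z" "Re z \<le> \<mu> n" "\<bar>Im z\<bar> \<ge> 1" for z
      using mult_mono[OF C(2)[OF z] powr_strip_bound[OF assms(2) z(1,2)]] C(1)
      by (simp add: f_def norm_mult)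
    have 2: "f holomorphic_on {z. \<kappa> - 1 < Re z \<and> Re z < c + real n + 1} - P n"
    proof -
      have "complex_of_real c - z \<notin> \<int>\<^sub>\<le>\<^sub>0" if "Re z < c + real n + 1" "z \<notin> P n" for z
        using that by (force simp: nonpos_Int_of_real_minus_iff P_def image_iff)
      thus ?thesis unfolding f_def using assms by (auto intro!: holomorphic_intros)
    qed
    have 3: "\<kappa> < Re p \<and> Re p < \<mu> n" if "p \<in> P n" for p
      using that assms by (auto simp: P_def \<mu>_def)
    have 4: "\<kappa> - 1 < \<kappa>" "\<kappa> < \<mu> n" "\<mu> n < c + real n + 1" "finite (P n)"
      using assms by (auto simp: P_def \<mu>_def)
    show "integrable lborel (\<lambda>t. f (Complex (\<mu> n) t))"
      "L (\<mu> n) - L \<kappa> = 2 * of_real pi * (\<Sum>p\<in>P n. residue f p)"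
      unfolding L_def by (rule line_integral_difference_residues(2,3)[OF 4 3 2 1]; assumption)+
  qed
  have "(\<lambda>n. L (\<mu> n)) \<longlonglongrightarrow> 0"
    unfolding L_def
  proof (rule integral_sequence_tendsto_0[OF shift(1)])
    fix n t
    let ?s = "Complex (\<mu> n) t"
    have s: "Complex (\<mu> (Suc n)) t = ?s + 1" by (simp add: complex_eq_iff \<mu>_def)
    have "of_real c - ?s - 1 \<notin> \<int>\<^sub>\<le>\<^sub>0"
    proof
      assume "of_real c - ?s - 1 \<in> \<int>\<^sub>\<le>\<^sub>0"
      hence "\<exists>m. of_real c - ?s - 1 = of_int m" by (auto elim: nonpos_Ints_cases)
      then obtain m where "of_real c - ?s - 1 = of_int m" by blast
      hence "Re (of_real c - ?s - 1) = of_int m" by simp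
      hence "of_int (2 * m) = (of_int (- 2 * int n - 3) :: real)" by (simp add: \<mu>_def)
      hence "2 * m = - 2 * int n - 3" by linarith
      thus False by presburger
    qed
    hence "f (?s + 1) = f ?s * (of_real y / (of_real c - ?s - 1))"
      using assms by (simp add: f_def Gamma_diff_plus_one powr_add)
    hence eq: "norm (f (?s + 1)) = norm (f ?s) * norm (of_real y / (of_real c - ?s - 1))"
      by (simp only: norm_mult)
    have "norm (of_real c - ?s - 1) \<ge> real n + 3/2"
      using abs_Re_le_cmod[of "of_real c - ?s - 1"] by (simp add: \<mu>_def)
    hence "norm (f ?s) * norm (of_real y / (of_real c - ?s - 1)) \<le> norm (f ?s) * (y / (real n + 3/2))"
      using assms by (intro mult_left_mono) (simp_all add: norm_divide frac_le)
    thus "norm (f (Complex (\<mu> (Suc n)) t)) \<le> (y / (real n + 3/2)) * norm (f ?s)"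
      unfolding s eq by (simp only: mult.commute)
  next
    show "(\<lambda>n. y / (real n + 3/2)) \<longlonglongrightarrow> 0"
      by real_asymp
  qed
  moreover have L_eq: "L (\<mu> n) = L \<kappa> - 2 * pi * y powr c * (\<Sum>k\<le>n. (- complex_of_real y) ^ k / fact k)" for n
  proof -
    have "(\<Sum>p\<in>P n. residue f p) = - (of_real (y powr c) * (\<Sum>k\<le>n. (- of_real y) ^ k / fact k))"
      by (simp add: P_def sum.reindex[OF P_inj] res sum_negf sum_distrib_left)
    thus ?thesis using shift(2)[of n] by (simp add: algebra_simps)
  qed
  hence "(\<lambda>n. L (\<mu> n)) \<longlonglongrightarrow> L \<kappa> - 2 * pi * y powr c * exp (- complex_of_real y)"
  proof -
    have "(\<lambda>n. \<Sum>k\<le>n. (- complex_of_real y) ^ k / fact k) \<longlonglongrightarrow> exp (- of_real y)"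
      using exp_converges[of "- complex_of_real y"]
      by (simp add: sums_def_le scaleR_conv_of_real field_simps)
    thus ?thesis unfolding L_eq by (intro tendsto_intros)
  qed
  ultimately have "L \<kappa> - 2 * pi * y powr c * exp (- complex_of_real y) = 0"
    using LIMSEQ_unique by blast
  thus ?thesis by (simp add: L_def f_def exp_of_real flip: of_real_minus)
qed

section \<open>A Beta integral with complex parameters\<close>

lemma Fubini_set_integral:
  fixes f :: "real \<Rightarrow> real \<Rightarrow> complex"
  assumes sets: "A \<in> sets borel" "B \<in> sets borel"
    and cont: "continuous_on (A \<times> B) (\<lambda>(x, y). f x y)"
    and int1: "\<And>x. x \<in> A \<Longrightarrow> set_integrable lborel B (f x)"
    and int2: "set_integrable lborel A (\<lambda>x. LINT y:B|lborel. norm (f x y))"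
  shows "(LINT x:A|lborel. LINT y:B|lborel. f x y) = (LINT y:B|lborel. LINT x:A|lborel. f x y)"
proof -
  define F where "F x y = indicat_real (A \<times> B) (x, y) *\<^sub>R f x y" for x y
  have F: "F x y = indicat_real A x *\<^sub>R (indicat_real B y *\<^sub>R f x y)"
    "F x y = indicat_real B y *\<^sub>R (indicat_real A x *\<^sub>R f x y)" for x y
    by (auto simp: F_def indicator_def)
  have F1: "F x = (\<lambda>y. indicat_real A x *\<^sub>R (indicat_real B y *\<^sub>R f x y))" for x
    by (simp add: fun_eq_iff F(1))
  have "(\<lambda>p. indicat_real (A \<times> B) p *\<^sub>R (case p of (x, y) \<Rightarrow> f x y)) \<in> borel_measurable borel"
    by (rule borel_measurable_continuous_on_indicator[OF borel_Times[OF sets] cont])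
  also have "(\<lambda>p. indicat_real (A \<times> B) p *\<^sub>R (case p of (x, y) \<Rightarrow> f x y)) = case_prod F"
    by (auto simp: F_def fun_eq_iff)
  finally have meas: "case_prod F \<in> borel_measurable (lborel \<Otimes>\<^sub>M lborel)"
    by (simp add: lborel_prod)
  have F_int: "integrable (lborel \<Otimes>\<^sub>M lborel) (case_prod F)"
  proof (rule lborel_pair.Fubini_integrable[OF meas])
    have "(LINT y|lborel. norm (case (x, y) of (x, y) \<Rightarrow> F x y)) =
        indicat_real A x *\<^sub>R (LINT y:B|lborel. norm (f x y))" for x
      unfolding set_lebesgue_integral_def by (simp add: F(1) indicator_def cong: if_cong)
    thus "integrable lborel (\<lambda>x. LINT y|lborel. norm (case (x, y) of (x, y) \<Rightarrow> F x y))"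
      using int2 by (simp add: set_integrable_def)
    have "integrable lborel (F x)" for x
      using int1[of x] by (cases "x \<in> A") (auto simp: F1 set_integrable_def)
    thus "AE x in lborel. integrable lborel (\<lambda>y. case (x, y) of (x, y) \<Rightarrow> F x y)" by simp
  qed
  have e1: "(LINT x|lborel. LINT y|lborel. F x y) = (LINT x:A|lborel. LINT y:B|lborel. f x y)"
    unfolding set_lebesgue_integral_def
    by (intro Bochner_Integration.integral_cong refl) (simp add: F1 indicator_def)
  have e2: "(LINT y|lborel. LINT x|lborel. F x y) = (LINT y:B|lborel. LINT x:A|lborel. f x y)"
    unfolding set_lebesgue_integral_def
    by (intro Bochner_Integration.integral_cong refl) (simp add: F(2) indicator_def)
  from lborel_pair.Fubini_integral[OF F_int]
  have "(LINT x|lborel. LINT y|lborel. F x y) = (LINT y|lborel. LINT x|lborel. F x y)" ..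
  thus ?thesis
    by (simp only: e1 e2)
qed

text \<open>
  The integrand is dominated by $v^{p-1}$ near 0 and by $v^{p-1-r}$ near infinity.
\<close>

lemma set_integrable_powr_Beta:
  fixes p r :: real
  assumes "0 < p" "p < r"
  shows "set_integrable lborel {0<..} (\<lambda>v. v powr (p - 1) * (1 + v) powr (- r))"
proof -
  let ?f = "\<lambda>v. v powr (p - 1) * (1 + v) powr (- r) :: real"
  have meas: "set_borel_measurable lborel A ?f" if "A \<in> sets borel" for A
    using that unfolding set_borel_measurable_def by measurable
  have leb: "set_integrable lborel A g"
    if "g integrable_on A" "\<And>x. x \<in> A \<Longrightarrow> g x \<ge> 0" "A \<in> sets borel" "g \<in> borel_measurable borel"
    for A and g :: "real \<Rightarrow> real"
  proof -
    have "set_integrable lebesgue A g" using that by (intro nonnegative_absolutely_integrable_1)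
    moreover have "(\<lambda>x. indicat_real A x *\<^sub>R g x) \<in> borel_measurable lborel"
      using that by (intro borel_measurable_scaleR borel_measurable_indicator) auto
    ultimately show ?thesis unfolding set_integrable_def by (simp add: integrable_completion)
  qed
  have "set_integrable lborel {0<..1} ?f"
  proof (rule set_integrable_bound)
    show "set_integrable lborel {0<..1} (\<lambda>v. v powr (p - 1))"
      using assms by (intro leb integrable_on_powr_from_0') auto
    show "set_borel_measurable lborel {0<..1} ?f" by (rule meas) auto
    have "(1 + v) powr (- r) \<le> 1" if "v > 0" for v
      using powr_mono[of "- r" 0 "1 + v"] that assms by simp
    thus "AE v in lborel. v \<in> {0<..1} \<longrightarrow> norm (?f v) \<le> norm (v powr (p - 1))"
      by (auto simp: abs_mult mult_left_le intro!: AE_I2)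
  qed
  moreover have "set_integrable lborel {1<..} ?f"
  proof (rule set_integrable_bound)
    show "set_integrable lborel {1<..} (\<lambda>v. v powr (p - 1 - r))"
    proof (rule set_integrable_subset)
      show "set_integrable lborel {1..} (\<lambda>v. v powr (p - 1 - r))"
        using assms has_integral_powr_to_inf[of "p - 1 - r" 1]
        by (intro leb) (auto simp: has_integral_integrable)
    qed auto
    show "set_borel_measurable lborel {1<..} ?f" by (rule meas) auto
    have "?f v \<le> v powr (p - 1 - r)" if "v > 1" for v
    proof -
      have "(1 + v) powr (- r) \<le> v powr (- r)"
        using that assms by (intro powr_mono2') auto
      hence "?f v \<le> v powr (p - 1) * v powr (- r)" by (intro mult_left_mono) auto
      thus ?thesis by (simp add: powr_add[symmetric])
    qed
    thus "AE v in lborel. v \<in> {1<..} \<longrightarrow> norm (?f v) \<le> norm (v powr (p - 1 - r))"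
      by (auto simp: abs_mult intro!: AE_I2)
  qed
  ultimately have "set_integrable lborel ({0<..1} \<union> {1<..}) ?f"
    by (rule set_integrable_Un) auto
  also have "{0<..1} \<union> {1<..} = {0::real<..}" by auto
  finally show ?thesis .
qed

text \<open>
  Integrate $v^{a-1} q^{a+b-1} e^{-(1+v)q}$ over the quadrant in both orders: the $q$-integral gives
  $\Gamma(a+b)\,(1+v)^{-(a+b)}$, the $v$-integral gives $\Gamma(a)\,q^{-a}$, and each remaining integral is again
  elementary.
\<close>

lemma
  assumes "Re a > 0" "Re b > 0"
  shows set_integrable_complex_Beta:
      "set_integrable lborel {0<..} (\<lambda>v. complex_of_real v powr (a - 1) * of_real (1 + v) powr (- (a + b)))"
    and complex_Beta_integral:
      "Gamma (a + b) * (LINT v:{0<..}|lborel. complex_of_real v powr (a - 1) * of_real (1 + v) powr (- (a + b))) =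
         Gamma a * Gamma b"
proof -
  let ?k = "\<lambda>v q. complex_of_real v powr (a - 1) * (of_real q powr (a + b - 1) * of_real (exp (- ((1 + v) * q))))"
  let ?B = "\<lambda>v. complex_of_real v powr (a - 1) * of_real (1 + v) powr (- (a + b))"
  have ab: "Re (a + b) > 0" using assms by simp
  show "set_integrable lborel {0<..} ?B"
  proof (rule set_integrable_bound)
    show "set_integrable lborel {0<..} (\<lambda>v. v powr (Re a - 1) * (1 + v) powr (- Re (a + b)))"
      by (rule set_integrable_powr_Beta) (use assms in auto)
    show "set_borel_measurable lborel {0<..} ?B"
      unfolding set_borel_measurable_def by measurable
    have "norm (of_real (1 + v) powr (- (a + b))) = (1 + v) powr (- Re (a + b))" if "v > 0" for v
      using norm_of_real_powr[of "1 + v" "- (a + b)"] that by simp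
    thus "AE v in lborel. v \<in> {0<..} \<longrightarrow> norm (?B v) \<le> norm (v powr (Re a - 1) * (1 + v) powr (- Re (a + b)))"
      by (auto simp: norm_mult norm_of_real_powr abs_mult intro!: AE_I2)
  qed
  have "(LINT v:{0<..}|lborel. LINT q:{0<..}|lborel. ?k v q) =
      (LINT q:{0<..}|lborel. LINT v:{0<..}|lborel. ?k v q)"
  proof (rule Fubini_set_integral)
    show "continuous_on ({0<..} \<times> {0<..}) (\<lambda>(v, q). ?k v q)"
      unfolding case_prod_unfold by (intro continuous_intros) auto
    fix v :: real assume "v \<in> {0<..}"
    thus "set_integrable lborel {0<..} (?k v)"
      using set_integrable_Gamma_integrand[OF ab, of "1 + v"] by (intro set_integrable_mult_right) auto
  next
    have "(LINT q:{0<..}|lborel. norm (?k v q)) =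
        Gamma (Re (a + b)) * (v powr (Re a - 1) * (1 + v) powr (- Re (a + b)))" if v: "v > 0" for v
    proof -
      let ?z = "complex_of_real (Re (a + b))"
      have "complex_of_real (LINT q:{0<..}|lborel. norm (?k v q)) =
          (LINT q:{0<..}|lborel. complex_of_real (norm (?k v q)))"
        by (rule set_integral_complex_of_real[symmetric])
      also have "\<dots> = (LINT q:{0<..}|lborel. of_real (v powr (Re a - 1)) *
          (of_real q powr (?z - 1) * of_real (exp (- ((1 + v) * q)))))"
        using v by (intro set_lebesgue_integral_cong)
          (auto simp: norm_mult norm_of_real_powr powr_of_real[symmetric])
      also have "\<dots> = of_real (v powr (Re a - 1)) * (Gamma ?z * of_real (1 + v) powr (- ?z))"
        by (subst set_integral_mult_right, subst Gamma_integral_scaled) (use v ab in auto)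
      also have "\<dots> = of_real (Gamma (Re (a + b)) * (v powr (Re a - 1) * (1 + v) powr (- Re (a + b))))"
        using v unfolding of_real_minus[symmetric]
        by (subst powr_of_real) (auto simp: Gamma_complex_of_real simp del: plus_complex.sel)
      finally show ?thesis unfolding of_real_eq_iff .
    qed
    moreover have "set_integrable lborel {0<..}
        (\<lambda>v. Gamma (Re (a + b)) * (v powr (Re a - 1) * (1 + v) powr (- Re (a + b))))"
      by (intro set_integrable_mult_right set_integrable_powr_Beta) (use assms in auto)
    ultimately show "set_integrable lborel {0<..} (\<lambda>v. LINT q:{0<..}|lborel. norm (?k v q))"
      by (subst set_integrable_cong) auto
  qed auto
  also have "(LINT v:{0<..}|lborel. LINT q:{0<..}|lborel. ?k v q) =
      (LINT v:{0<..}|lborel. Gamma (a + b) * ?B v)"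
  proof (intro set_lebesgue_integral_cong)
    show "\<forall>v. v \<in> {0<..} \<longrightarrow> (LINT q:{0<..}|lborel. ?k v q) = Gamma (a + b) * ?B v"
    proof (intro allI impI)
      fix v :: real assume "v \<in> {0<..}"
      thus "(LINT q:{0<..}|lborel. ?k v q) = Gamma (a + b) * ?B v"
        by (subst set_integral_mult_right, subst Gamma_integral_scaled[OF ab]) auto
    qed
  qed auto
  also have "\<dots> = Gamma (a + b) * (LINT v:{0<..}|lborel. ?B v)"
    by (rule set_integral_mult_right)
  also have "(LINT q:{0<..}|lborel. LINT v:{0<..}|lborel. ?k v q) =
      (LINT q:{0<..}|lborel. Gamma a * (of_real q powr (b - 1) * of_real (exp (- (1 * q)))))"
  proof (intro set_lebesgue_integral_cong)
    show "\<forall>q. q \<in> {0<..} \<longrightarrow> (LINT v:{0<..}|lborel. ?k v q) =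
        Gamma a * (of_real q powr (b - 1) * of_real (exp (- (1 * q))))"
    proof (intro allI impI)
      fix q :: real assume q: "q \<in> {0<..}"
      have "(LINT v:{0<..}|lborel. ?k v q) = (LINT v:{0<..}|lborel.
          of_real q powr (a + b - 1) * of_real (exp (- q)) * (of_real v powr (a - 1) * of_real (exp (- (q * v)))))"
        by (intro set_lebesgue_integral_cong) (auto simp: algebra_simps exp_add[symmetric] simp flip: exp_of_real)
      also have "\<dots> = of_real q powr (a + b - 1) * of_real (exp (- q)) * (Gamma a * of_real q powr (- a))"
        by (subst set_integral_mult_right, subst Gamma_integral_scaled) (use q assms in auto)
      also have "\<dots> = Gamma a * (of_real q powr (b - 1) * of_real (exp (- (1 * q))))"
        using q by (simp add: powr_add powr_diff powr_minus field_simps)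
      finally show "(LINT v:{0<..}|lborel. ?k v q) =
        Gamma a * (of_real q powr (b - 1) * of_real (exp (- (1 * q))))" .
    qed
  qed auto
  also have "\<dots> = Gamma a * Gamma b"
    by (subst set_integral_mult_right, subst Gamma_integral_scaled) (use assms in auto)
  finally show "Gamma (a + b) * (LINT v:{0<..}|lborel. ?B v) = Gamma a * Gamma b" .
qed

section \<open>The Barnes integral as a Laplace-type integral\<close>

lemma continuous_on_Gamma_compose:
  assumes "continuous_on A f" "\<And>x. x \<in> A \<Longrightarrow> f x \<notin> \<int>\<^sub>\<le>\<^sub>0"
  shows "continuous_on A (\<lambda>x. Gamma (f x :: complex))"
  by (rule continuous_on_compose2[OF continuous_on_Gamma assms(1), of "- \<int>\<^sub>\<le>\<^sub>0"]) (use assms(2) in auto)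

definition Barnes_integrand :: "real \<Rightarrow> real \<Rightarrow> real \<Rightarrow> real \<Rightarrow> complex \<Rightarrow> complex" where
  "Barnes_integrand a c d x s =
     Gamma (of_real a + s) * Gamma (of_real c - s) * Gamma (of_real d - s) * of_real x powr s"

text \<open>
  The exchange of integrals is legitimate because, on the line, the modulus of the double integrand is the
  product of $|\Gamma(d - \kappa - it)|$, integrable in $t$, and a multiple of the Beta density with the real parameters
  $a + \kappa$ and $c - \kappa$.
\<close>

lemma line_integral_Barnes_integrand:
  fixes a c d \<kappa> x :: real
  assumes sep: "- a < \<kappa>" "\<kappa> < c" "\<kappa> < d" and x: "x > 0"
  shows "integrable lborel (\<lambda>t. Barnes_integrand a c d x (Complex \<kappa> t))"
    and "(LINT t|lborel. Barnes_integrand a c d x (Complex \<kappa> t)) =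
           of_real (2 * pi * (Gamma (a + c) * x powr d *
             (LINT v:{0<..}|lborel. v powr (a + d - 1) * (1 + v) powr (- (a + c)) * exp (- (x * v)))))"
proof -
  have Cplx: "Complex \<kappa> t = of_real \<kappa> + \<i> * of_real t" for t
    by (simp add: complex_eq_iff)
  have npos: "z \<notin> \<int>\<^sub>\<le>\<^sub>0" if "Re z > 0" for z
    using that by (auto elim!: nonpos_Ints_cases)
  define G3 where "G3 t = Gamma (of_real d - Complex \<kappa> t)" for t
  have G3_cont: "continuous_on UNIV G3"
    unfolding G3_def Cplx using sep by (intro continuous_on_Gamma_compose continuous_intros npos) auto
  obtain C where C: "C \<ge> 0" "\<And>t. \<bar>t\<bar> \<ge> 1 \<Longrightarrow> norm (G3 t) \<le> C / t\<^sup>2"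
    unfolding G3_def using Gamma_reflect_vertical_decay[of \<kappa> \<kappa> "d"]
    by (metis complex.sel order_refl)
  have G3_int: "integrable lborel G3"
    by (rule integrable_vertical_line[OF G3_cont C(2)])
  have G12: "norm (Gamma (of_real a + Complex \<kappa> t) * Gamma (of_real c - Complex \<kappa> t))
      \<le> Gamma (a + \<kappa>) * Gamma (c - \<kappa>)" for t
    unfolding norm_mult using sep
    by (intro mult_mono order_trans[OF norm_Gamma_le]) (auto intro!: Gamma_real_nonneg)
  show "integrable lborel (\<lambda>t. Barnes_integrand a c d x (Complex \<kappa> t))"
  proof (rule integrable_vertical_line)
    show "continuous_on UNIV (\<lambda>t. Barnes_integrand a c d x (Complex \<kappa> t))"
      unfolding Barnes_integrand_def Cplx using sep x by (intro continuous_on_mult continuous_on_Gamma_compose continuous_intros npos) auto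
    fix t :: real assume t: "\<bar>t\<bar> \<ge> 1"
    have "norm (Barnes_integrand a c d x (Complex \<kappa> t)) \<le> Gamma (a + \<kappa>) * Gamma (c - \<kappa>) * (C / t\<^sup>2) * x powr \<kappa>"
      unfolding Barnes_integrand_def norm_mult[of _ "_ powr _"] norm_mult[of _ "Gamma (of_real d - _)"]
      using x C(1) C(2)[OF t] sep
      by (intro mult_mono G12) (auto simp: G3_def norm_of_real_powr)
    thus "norm (Barnes_integrand a c d x (Complex \<kappa> t)) \<le> (Gamma (a + \<kappa>) * Gamma (c - \<kappa>) * C * x powr \<kappa>) / t\<^sup>2"
      by simp
  qed
  let ?f = "\<lambda>t v. G3 t * of_real x powr Complex \<kappa> t *
     (of_real v powr (of_real a + Complex \<kappa> t - 1) * of_real (1 + v) powr (- of_real (a + c)))"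
  have Beta: "set_integrable lborel {0<..} (\<lambda>v. of_real v powr (of_real a + Complex \<kappa> t - 1) * of_real (1 + v) powr (- of_real (a + c)))"
    "Gamma (a + c) * (LINT v:{0<..}|lborel. of_real v powr (of_real a + Complex \<kappa> t - 1) * of_real (1 + v) powr (- of_real (a + c)))
     = Gamma (of_real a + Complex \<kappa> t) * Gamma (of_real c - Complex \<kappa> t)" for t
  proof -
    let ?a = "complex_of_real a + Complex \<kappa> t" and ?b = "complex_of_real c - Complex \<kappa> t"
    have sum: "?a + ?b = of_real (a + c)" by (simp add:)
    show "set_integrable lborel {0<..} (\<lambda>v. of_real v powr (?a - 1) * of_real (1 + v) powr (- of_real (a + c)))"
      using set_integrable_complex_Beta[of ?a ?b] sep unfolding sum by simp
    show "Gamma (a + c) * (LINT v:{0<..}|lborel. of_real v powr (?a - 1) * of_real (1 + v) powr (- of_real (a + c))) = Gamma ?a * Gamma ?b"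
      using complex_Beta_integral[of ?a ?b] sep unfolding sum by (simp flip: Gamma_complex_of_real)
  qed
  have pt: "Barnes_integrand a c d x (Complex \<kappa> t) = Gamma (a + c) * (LINT v:{0<..}|lborel. ?f t v)" for t
  proof -
    have "Barnes_integrand a c d x (Complex \<kappa> t) = G3 t * of_real x powr Complex \<kappa> t *
        (Gamma (of_real a + Complex \<kappa> t) * Gamma (of_real c - Complex \<kappa> t))"
      by (simp add: Barnes_integrand_def G3_def mult_ac)
    also have "\<dots> = Gamma (a + c) * (LINT v:{0<..}|lborel. ?f t v)"
      unfolding set_integral_mult_right Beta(2)[symmetric] by (rule mult.left_commute)
    finally show ?thesis .
  qed
  have "(LINT t|lborel. Barnes_integrand a c d x (Complex \<kappa> t)) = (LINT t:UNIV|lborel. Gamma (a + c) * (LINT v:{0<..}|lborel. ?f t v))"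
    unfolding set_lebesgue_integral_def[of _ UNIV] by (simp only: pt indicator_UNIV scaleR_one)
  also have "\<dots> = Gamma (a + c) * (LINT t:UNIV|lborel. LINT v:{0<..}|lborel. ?f t v)"
    by (rule set_integral_mult_right)
  also have "(LINT t:UNIV|lborel. LINT v:{0<..}|lborel. ?f t v) = (LINT v:{0<..}|lborel. LINT t:UNIV|lborel. ?f t v)"
  proof (rule Fubini_set_integral)
    show "continuous_on (UNIV \<times> {0<..}) (\<lambda>(t, v). ?f t v)"
      unfolding case_prod_unfold
      by (intro continuous_on_mult continuous_on_compose2[OF G3_cont])
         (unfold Cplx, use x in \<open>auto intro!: continuous_intros simp: complex_eq_iff\<close>)
    show "set_integrable lborel {0<..} (?f t)" for t
      by (intro set_integrable_mult_right Beta(1))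
    have *: "(LINT v:{0<..}|lborel. norm (?f t v)) = norm (G3 t) * (x powr \<kappa> *
        (LINT v:{0<..}|lborel. v powr (a + \<kappa> - 1) * (1 + v) powr (- (a + c))))" for t
    proof -
      have "norm (?f t v) = norm (G3 t) * (x powr \<kappa> * (v powr (a + \<kappa> - 1) * (1 + v) powr (- (a + c))))" if "v > 0" for v
      proof -
        have "norm (of_real (1 + v) powr (- complex_of_real (a + c))) = (1 + v) powr (- (a + c))"
          using norm_of_real_powr[of "1 + v" "- complex_of_real (a + c)"] that by simp
        thus ?thesis using that x by (simp add: norm_mult norm_of_real_powr)
      qed
      hence "(LINT v:{0<..}|lborel. norm (?f t v)) = (LINT v:{0<..}|lborel.
          norm (G3 t) * (x powr \<kappa> * (v powr (a + \<kappa> - 1) * (1 + v) powr (- (a + c)))))"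
        by (intro set_lebesgue_integral_cong) auto
      thus ?thesis by simp
    qed
    show "set_integrable lborel UNIV (\<lambda>t. LINT v:{0<..}|lborel. norm (?f t v))"
      unfolding * set_integrable_def using G3_int by simp
  qed auto
  also have "\<dots> = (LINT v:{0<..}|lborel. of_real (2 * pi * x powr d *
      (v powr (a + d - 1) * (1 + v) powr (- (a + c)) * exp (- (x * v)))))"
  proof (intro set_lebesgue_integral_cong)
    show "\<forall>v. v \<in> {0<..} \<longrightarrow> (LINT t:UNIV|lborel. ?f t v) = of_real (2 * pi * x powr d *
      (v powr (a + d - 1) * (1 + v) powr (- (a + c)) * exp (- (x * v))))"
    proof (intro allI impI)
      fix v :: real assume "v \<in> {0<..}"
      hence v: "v > 0" by simp
      have "?f t v = of_real (v powr (a - 1) * (1 + v) powr (- (a + c))) * (G3 t * of_real (x * v) powr Complex \<kappa> t)" for t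
      proof -
        have "of_real v powr (of_real a + Complex \<kappa> t - 1) = of_real (v powr (a - 1)) * of_real v powr Complex \<kappa> t"
          using v by (simp add: powr_add[symmetric] algebra_simps flip: powr_of_real)
        moreover have "of_real (1 + v) powr (- complex_of_real (a + c)) = of_real ((1 + v) powr (- (a + c)))"
          using v powr_of_real[of "1 + v" "- (a + c)"] by simp
        moreover have "of_real (x * v) powr Complex \<kappa> t = of_real x powr Complex \<kappa> t * of_real v powr Complex \<kappa> t"
          using x v by (simp add: powr_times_real)
        ultimately show ?thesis by simp
      qed
      note eqv = this
      have "(LINT t:UNIV|lborel. ?f t v) = of_real (v powr (a - 1) * (1 + v) powr (- (a + c))) *
          (LINT t|lborel. G3 t * of_real (x * v) powr Complex \<kappa> t)"
        by (simp only: eqv set_lebesgue_integral_def indicator_UNIV scaleR_one integral_mult_right_zero)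
      also have "(LINT t|lborel. G3 t * of_real (x * v) powr Complex \<kappa> t) =
          of_real (2 * pi * ((x * v) powr d * exp (- (x * v))))"
        unfolding G3_def using sep x v by (intro Gamma_inverse_Mellin) auto
      also have "of_real (v powr (a - 1) * (1 + v) powr (- (a + c))) * \<dots> =
          of_real (v powr (a - 1) * (1 + v) powr (- (a + c)) * (2 * pi * ((x * v) powr d * exp (- (x * v)))))"
        by simp
      also have "v powr (a - 1) * (1 + v) powr (- (a + c)) * (2 * pi * ((x * v) powr d * exp (- (x * v)))) =
          2 * pi * x powr d * ((v powr (a - 1) * v powr d) * (1 + v) powr (- (a + c)) * exp (- (x * v)))"
        using x v by (simp add: powr_mult)
      also have "v powr (a - 1) * v powr d = v powr (a + d - 1)"
        by (simp add: powr_add[symmetric] algebra_simps)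
      finally show "(LINT t:UNIV|lborel. ?f t v) = of_real (2 * pi * x powr d *
        (v powr (a + d - 1) * (1 + v) powr (- (a + c)) * exp (- (x * v))))" .
    qed
  qed auto
  also have "\<dots> = of_real (2 * pi * x powr d *
      (LINT v:{0<..}|lborel. v powr (a + d - 1) * (1 + v) powr (- (a + c)) * exp (- (x * v))))"
    by (simp only: set_integral_complex_of_real set_integral_mult_right)
  finally show "(LINT t|lborel. Barnes_integrand a c d x (Complex \<kappa> t)) =
           of_real (2 * pi * (Gamma (a + c) * x powr d *
             (LINT v:{0<..}|lborel. v powr (a + d - 1) * (1 + v) powr (- (a + c)) * exp (- (x * v)))))"
    by simp
qed

lemma set_integrable_powr_exp:
  fixes p x r :: real
  assumes "p > -1" "x > 0" "r \<ge> 0" "u \<ge> 0"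
  shows "set_integrable lborel {0<..} (\<lambda>v. v powr p * (1 + u * v) powr (- r) * exp (- (x * v)))"
proof (rule set_integrable_bound)
  show "set_integrable lborel {0<..} (\<lambda>t. complex_of_real t powr (of_real (p + 1) - 1) * of_real (exp (- (x * t))))"
    by (rule set_integrable_Gamma_integrand) (use assms in auto)
  show "set_borel_measurable lborel {0<..} (\<lambda>v. v powr p * (1 + u * v) powr (- r) * exp (- (x * v)))"
    unfolding set_borel_measurable_def by measurable
  have "(1 + u * v) powr (- r) \<le> 1" if "v > 0" for v
  proof -
    have "1 + u * v \<ge> 1" using that assms by simp
    thus ?thesis using powr_mono[of "- r" 0 "1 + u * v"] assms by (simp split: if_splits)
  qed
  hence "v powr p * exp (- (x * v)) * (1 + u * v) powr (- r) \<le> v powr p * exp (- (x * v)) * 1" if "v > 0" for v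
    using that by (intro mult_left_mono) auto
  thus "AE v in lborel. v \<in> {0<..} \<longrightarrow> norm (v powr p * (1 + u * v) powr (- r) * exp (- (x * v))) \<le>
      norm (complex_of_real v powr (of_real (p + 1) - 1) * of_real (exp (- (x * v))))"
    by (intro AE_I2) (simp add: abs_mult norm_mult norm_of_real_powr mult_ac)
qed

lemma set_integral_rescale_powr:
  fixes p x r u :: real
  assumes "u > 0"
  shows "(LINT v:{0<..}|lborel. v powr p * (1 + v) powr (- r) * exp (- (x * v / u))) =
           u powr (p + 1) * (LINT v:{0<..}|lborel. v powr p * (1 + u * v) powr (- r) * exp (- (x * v)))"
proof -
  have "(LINT v:{0<..}|lborel. v powr p * (1 + v) powr (- r) * exp (- (x * v / u))) =
      u *\<^sub>R (LINT v|lborel. indicator {0<..} (u * v) *\<^sub>R ((u * v) powr p * (1 + u * v) powr (- r) * exp (- (x * (u * v) / u))))"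
    unfolding set_lebesgue_integral_def
    using assms by (subst lborel_integral_real_affine[where c = u and t = 0]) auto
  also have "(LINT v|lborel. indicator {0<..} (u * v) *\<^sub>R ((u * v) powr p * (1 + u * v) powr (- r) * exp (- (x * (u * v) / u)))) =
      (LINT v|lborel. u powr p * (indicator {0<..} v *\<^sub>R (v powr p * (1 + u * v) powr (- r) * exp (- (x * v)))))"
    using assms by (intro Bochner_Integration.integral_cong)
      (auto simp: indicator_def zero_less_mult_iff powr_mult)
  also have "u *\<^sub>R \<dots> = u powr (p + 1) * (LINT v:{0<..}|lborel. v powr p * (1 + u * v) powr (- r) * exp (- (x * v)))"
    unfolding set_lebesgue_integral_def integral_mult_right_zero using assms by (simp add: powr_add)
  finally show ?thesis .
qed

section \<open>The residue series of the Barnes integral\<close>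

lemma sums_hyp_1F1:
  fixes a b z :: real
  assumes "b \<notin> \<int>\<^sub>\<le>\<^sub>0"
  shows "(\<lambda>k. pochhammer a k / pochhammer b k * z ^ k / fact k) sums hyp_1F1 a b z"
proof -
  define t where "t k = pochhammer a k / pochhammer b k * z ^ k / fact k" for k
  have b: "b + real k \<noteq> 0" for k
    using assms by (metis add.commute add_eq_0_iff minus_of_nat_in_nonpos_Ints)
  have "(\<lambda>k. (a + real k) / ((b + real k) * (real k + 1))) \<longlonglongrightarrow> 0"
    by real_asymp
  hence "(\<lambda>k. \<bar>(a + real k) / ((b + real k) * (real k + 1)) * z\<bar>) \<longlonglongrightarrow> 0"
    by (intro tendsto_rabs_zero tendsto_mult_left_zero)
  hence "(\<lambda>k. \<bar>(a + real k) * z / ((b + real k) * (real k + 1))\<bar>) \<longlonglongrightarrow> 0"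
    by simp
  hence "eventually (\<lambda>k. \<bar>(a + real k) * z / ((b + real k) * (real k + 1))\<bar> < 1/2) sequentially"
    by (rule order_tendstoD) auto
  then obtain N where N: "\<And>k. k \<ge> N \<Longrightarrow> \<bar>(a + real k) * z / ((b + real k) * (real k + 1))\<bar> < 1/2"
    by (auto simp: eventually_sequentially)
  have "norm (t (Suc k)) \<le> 1/2 * norm (t k)" if "k \<ge> N" for k
  proof -
    have "t (Suc k) = (a + real k) * z / ((b + real k) * (real k + 1)) * t k"
      by (simp add: t_def pochhammer_rec' field_simps)
    hence "norm (t (Suc k)) = \<bar>(a + real k) * z / ((b + real k) * (real k + 1))\<bar> * norm (t k)"
      by (simp only: norm_mult) simp
    thus ?thesis using mult_right_mono[OF less_imp_le[OF N[OF that]] norm_ge_zero[of "t k"]] by simp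
  qed
  hence "summable t" by (intro summable_ratio_test[of "1/2" N]) auto
  thus ?thesis unfolding hyp_1F1_eq_suminf t_def by (rule summable_sums)
qed

lemma Gamma_minus_of_nat:
  fixes e :: real
  assumes "e \<notin> \<int>"
  shows "Gamma (e - of_nat k) = (-1) ^ k * Gamma e / pochhammer (1 - e) k"
proof -
  have ek: "e - of_nat k \<notin> \<int>" using assms by (metis Ints_add Ints_of_nat diff_add_cancel)
  hence np: "e - of_nat k \<notin> \<int>\<^sub>\<le>\<^sub>0" using nonpos_Ints_Int by blast
  have "pochhammer (e - of_nat k) k = Gamma e / Gamma (e - of_nat k)"
    using pochhammer_Gamma[OF np, of k] by simp
  moreover have "pochhammer (e - of_nat k) k = (-1) ^ k * pochhammer (1 - e) k"
    using pochhammer_minus'[of "e - 1" k] by (simp add: algebra_simps)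
  moreover have "Gamma (e - of_nat k) \<noteq> 0" using np by (simp add: Gamma_eq_zero_iff)
  moreover have "pochhammer (1 - e) k \<noteq> 0"
  proof
    assume "pochhammer (1 - e) k = 0"
    then obtain j where "1 - e = - of_nat j" by (auto simp: pochhammer_eq_0_iff)
    hence "e = of_nat (Suc j)" by (simp add: algebra_simps)
    thus False using assms by (metis Ints_of_nat)
  qed
  ultimately have e: "Gamma e = (-1) ^ k * pochhammer (1 - e) k * Gamma (e - of_nat k)"
    and nz: "pochhammer (1 - e) k \<noteq> 0"
    by (simp_all add: field_simps)
  have "(-1) ^ k * Gamma e / pochhammer (1 - e) k = ((-1) ^ k * (-1) ^ k) * Gamma (e - of_nat k)"
    unfolding e using nz by (simp del: power_mult_distrib)
  also have "(-1) ^ k * (-1) ^ k = (1 :: real)" by (simp flip: power_mult_distrib)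
  finally show ?thesis by simp
qed

lemma Barnes_integrand_commute: "Barnes_integrand a c d x = Barnes_integrand a d c x"
  by (simp add: Barnes_integrand_def fun_eq_iff mult_ac)

text \<open>
  Non-integrality of $c - d$ keeps the poles of $\Gamma(c - s)$ and $\Gamma(d - s)$ apart, so each of them is
  simple. By the symmetry of the integrand in $c$ and $d$ this also yields the residues at $d + k$.
\<close>

lemma residue_Barnes_integrand:
  fixes a c d x :: real
  assumes "- a < c" "c - d \<notin> \<int>" "x > 0"
  shows "residue (Barnes_integrand a c d x) (of_real c + of_nat k) =
    - of_real (Gamma (a + c) * Gamma (d - c) * x powr c *
        (pochhammer (a + c) k / pochhammer (1 + c - d) k * x ^ k / fact k))"
proof -
  let ?h = "\<lambda>s. Gamma (of_real a + s) * Gamma (of_real d - s) * complex_of_real x powr s"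
  let ?U = "{s. - a < Re s} \<inter> (\<lambda>s. of_real d - s) -` (- \<int>\<^sub>\<le>\<^sub>0)"
  have dc: "d - c \<notin> \<int>" using assms(2) by (metis Ints_minus minus_diff_eq)
  have dck: "d - c - real k \<notin> \<int>" using dc by (metis Ints_add Ints_of_nat diff_add_cancel)
  have npos: "z \<notin> \<int>\<^sub>\<le>\<^sub>0" if "Re z > 0" for z
    using that by (auto elim!: nonpos_Ints_cases)
  have "residue (\<lambda>s. Gamma (of_real c - s) * ?h s) (of_real c + of_nat k) =
      - ((-1) ^ k / fact k * ?h (of_real c + of_nat k))"
  proof (rule residue_Gamma_diff_mult)
    have op: "open (- (\<int>\<^sub>\<le>\<^sub>0) :: complex set)" by (intro open_Compl) auto
    show "open ?U" by (intro open_Int open_halfspace_Re_gt open_vimage[OF op] continuous_intros)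
    have "complex_of_real d - (of_real c + of_nat k) = of_real (d - c - real k)" by simp
    also have "\<dots> \<notin> \<int>\<^sub>\<le>\<^sub>0" using dck nonpos_Ints_Int unfolding of_real_in_nonpos_Ints_iff by blast
    finally show "of_real c + of_nat k \<in> ?U" using assms by simp
    show "?h holomorphic_on ?U"
      using assms by (intro holomorphic_intros) (use npos[of "of_real a + z" for z] in auto)
  qed
  also have "(\<lambda>s. Gamma (of_real c - s) * ?h s) = Barnes_integrand a c d x"
    by (simp add: Barnes_integrand_def fun_eq_iff mult_ac)
  also have "?h (of_real c + of_nat k) = of_real (Gamma (a + c + real k) * Gamma (d - c - real k) * (x powr c * x ^ k))"
  proof -
    have "Gamma (of_real a + (of_real c + of_nat k)) = complex_of_real (Gamma (a + c + real k))"
      unfolding Gamma_complex_of_real[symmetric] by (simp add: add_ac)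
    moreover have "Gamma (of_real d - (of_real c + of_nat k)) = complex_of_real (Gamma (d - c - real k))"
      unfolding Gamma_complex_of_real[symmetric] by (simp add: algebra_simps)
    moreover have "complex_of_real x powr (of_real c + of_nat k) = of_real (x powr c * x ^ k)"
      using assms by (simp add: powr_add powr_of_real powr_nat)
    ultimately show ?thesis by simp
  qed
  also have "Gamma (a + c + real k) = pochhammer (a + c) k * Gamma (a + c)"
  proof -
    have "a + c \<notin> \<int>\<^sub>\<le>\<^sub>0" using assms by (auto elim!: nonpos_Ints_cases)
    thus ?thesis by (simp add: pochhammer_Gamma Gamma_eq_zero_iff)
  qed
  also have "Gamma (d - c - real k) = (-1) ^ k * Gamma (d - c) / pochhammer (1 + c - d) k"
    using Gamma_minus_of_nat[OF dc, of k] by (simp add: algebra_simps)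
  finally show ?thesis by (simp add: field_simps)
qed

lemma norm_Barnes_integrand_decay:
  fixes a b c d x \<kappa> :: real
  assumes "x > 0"
  obtains C where "\<And>z. \<kappa> \<le> Re z \<Longrightarrow> Re z \<le> b \<Longrightarrow> \<bar>Im z\<bar> \<ge> 1 \<Longrightarrow>
    norm (Barnes_integrand a c d x z) \<le> C / (Im z)\<^sup>2"
proof -
  obtain C1 where C1: "C1 \<ge> 0" "\<And>z. a + \<kappa> \<le> Re z \<Longrightarrow> Re z \<le> a + b \<Longrightarrow> \<bar>Im z\<bar> \<ge> 1 \<Longrightarrow>
      norm (Gamma z) \<le> C1 / (Im z)\<^sup>2"
    using norm_Gamma_decay[of "a + \<kappa>" "a + b"] by blast
  obtain C2 where C2: "C2 \<ge> 0" "\<And>z. \<kappa> \<le> Re z \<Longrightarrow> Re z \<le> b \<Longrightarrow> \<bar>Im z\<bar> \<ge> 1 \<Longrightarrow>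
      norm (Gamma (of_real c - z)) \<le> C2 / (Im z)\<^sup>2"
    using Gamma_reflect_vertical_decay[of \<kappa> b c] by blast
  obtain C3 where C3: "C3 \<ge> 0" "\<And>z. \<kappa> \<le> Re z \<Longrightarrow> Re z \<le> b \<Longrightarrow> \<bar>Im z\<bar> \<ge> 1 \<Longrightarrow>
      norm (Gamma (of_real d - z)) \<le> C3 / (Im z)\<^sup>2"
    using Gamma_reflect_vertical_decay[of \<kappa> b d] by blast
  show ?thesis
  proof (rule that)
    fix z assume z: "\<kappa> \<le> Re z" "Re z \<le> b" "\<bar>Im z\<bar> \<ge> 1"
    have "1 \<le> \<bar>Im z\<bar> ^ 2" using z(3) by (rule one_le_power)
    hence im: "(Im z)\<^sup>2 \<ge> 1" by simp
    have drop: "C / (Im z)\<^sup>2 \<le> C" if "C \<ge> 0" for C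
      using that im z(3) divide_left_mono[of 1 "(Im z)\<^sup>2" C] by fastforce
    have "norm (Barnes_integrand a c d x z) \<le> C1 / (Im z)\<^sup>2 * C2 * C3 * (x powr \<kappa> + x powr b)"
      unfolding Barnes_integrand_def norm_mult
      using C1(1) C2(1) C3(1) z C1(2)[of "of_real a + z"] assms
      by (intro mult_mono powr_strip_bound order_trans[OF C2(2) drop] order_trans[OF C3(2) drop]) auto
    thus "norm (Barnes_integrand a c d x z) \<le> (C1 * C2 * C3 * (x powr \<kappa> + x powr b)) / (Im z)\<^sup>2"
      by simp
  qed
qed

lemma Barnes_integrand_plus_one:
  fixes a c d x :: real
  assumes "x > 0" "of_real a + s \<notin> \<int>\<^sub>\<le>\<^sub>0" "of_real c - s - 1 \<notin> \<int>\<^sub>\<le>\<^sub>0" "of_real d - s - 1 \<notin> \<int>\<^sub>\<le>\<^sub>0"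
  shows "Barnes_integrand a c d x (s + 1) = Barnes_integrand a c d x s *
           ((of_real a + s) * of_real x / ((of_real c - s - 1) * (of_real d - s - 1)))"
proof -
  have "Gamma (of_real a + (s + 1)) = (of_real a + s) * Gamma (of_real a + s)"
    using Gamma_plus1[OF assms(2)] by (simp add: add_ac)
  thus ?thesis
    unfolding Barnes_integrand_def Gamma_diff_plus_one[OF assms(3)] Gamma_diff_plus_one[OF assms(4)]
    using assms(1) by (simp add: powr_add)
qed

text \<open>
  The quotient $F(s+1)/F(s) = x\,\frac{a+s}{(c-s-1)(d-s-1)}$ tends to 0 uniformly on the lines
  $\Re s = \mu + n$: write $\frac{a+s}{c-s-1} = \frac{a+c-1}{c-s-1} - 1$, which stays bounded, while
  $|d-s-1| \ge |d-\mu-n-1|$ grows.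
\<close>

lemma line_integral_Barnes_tendsto_0:
  fixes a c d x \<mu> :: real
  assumes "x > 0" "- a < \<mu>" "\<mu> - c \<notin> \<int>" "\<mu> - d \<notin> \<int>"
    and int: "\<And>n. integrable lborel (\<lambda>t. Barnes_integrand a c d x (Complex (\<mu> + real n) t))"
  shows "(\<lambda>n. LINT t|lborel. Barnes_integrand a c d x (Complex (\<mu> + real n) t)) \<longlonglongrightarrow> 0"
proof (rule integral_sequence_tendsto_0[OF int])
  let ?r = "\<lambda>n. (1 + \<bar>a + c - 1\<bar> / \<bar>c - (\<mu> + real n) - 1\<bar>) * (x / \<bar>d - (\<mu> + real n) - 1\<bar>)"
  show "?r \<longlonglongrightarrow> 0" by real_asymp
  fix n t
  let ?s = "Complex (\<mu> + real n) t"
  have nint: "e - (\<mu> + real n) - 1 \<notin> \<int>" if "\<mu> - e \<notin> \<int>" for e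
  proof
    assume h: "e - (\<mu> + real n) - 1 \<in> \<int>"
    have "- (e - (\<mu> + real n) - 1) - of_nat (Suc n) \<in> \<int>"
      by (rule Ints_diff[OF Ints_minus[OF h] Ints_of_nat])
    thus False using that by (simp add: algebra_simps)
  qed
  have notin: "of_real e - ?s - 1 \<notin> \<int>\<^sub>\<le>\<^sub>0" if "\<mu> - e \<notin> \<int>" for e
  proof
    assume "of_real e - ?s - 1 \<in> \<int>\<^sub>\<le>\<^sub>0"
    then obtain m :: int where "of_real e - ?s - 1 = of_int m" by (auto elim!: nonpos_Ints_cases)
    hence "Re (of_real e - ?s - 1) = of_int m" by simp
    hence "e - (\<mu> + real n) - 1 = of_int m" by simp
    thus False using nint[OF that] by (metis Ints_of_int)
  qed
  have pos: "\<bar>e - (\<mu> + real n) - 1\<bar> > 0" "norm (of_real e - ?s - 1) \<ge> \<bar>e - (\<mu> + real n) - 1\<bar>"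
    if "\<mu> - e \<notin> \<int>" for e
    using nint[OF that] abs_Re_le_cmod[of "of_real e - ?s - 1"] by auto
  note pc = pos[OF assms(3)] and pd = pos[OF assms(4)]
  have "of_real a + ?s \<notin> \<int>\<^sub>\<le>\<^sub>0"
    using assms(2) by (auto elim!: nonpos_Ints_cases simp: complex_eq_iff)
  note step = Barnes_integrand_plus_one[OF assms(1) this notin[OF assms(3)] notin[OF assms(4)]]
  have "Complex (\<mu> + real (Suc n)) t = ?s + 1" by (simp add: complex_eq_iff)
  hence eq: "norm (Barnes_integrand a c d x (Complex (\<mu> + real (Suc n)) t)) = norm (Barnes_integrand a c d x ?s) *
      (norm ((of_real a + ?s) / (of_real c - ?s - 1)) * (x / norm (of_real d - ?s - 1)))"
    using assms(1) by (simp add: step norm_mult norm_divide)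
  have "norm ((of_real a + ?s) / (of_real c - ?s - 1)) = norm (of_real (a + c - 1) / (of_real c - ?s - 1) - 1)"
  proof -
    have "of_real c - ?s - 1 \<noteq> 0" using pc by auto
    hence "(of_real a + ?s) / (of_real c - ?s - 1) = of_real (a + c - 1) / (of_real c - ?s - 1) - 1"
      by (simp add: field_simps)
    thus ?thesis by simp
  qed
  also have "\<dots> \<le> norm (complex_of_real (a + c - 1) / (of_real c - ?s - 1)) + 1"
    using norm_triangle_ineq4[of "of_real (a + c - 1) / (of_real c - ?s - 1)" 1] by simp
  also have "norm (complex_of_real (a + c - 1) / (of_real c - ?s - 1)) \<le> \<bar>a + c - 1\<bar> / \<bar>c - (\<mu> + real n) - 1\<bar>"
    unfolding norm_divide norm_of_real using pc by (intro frac_le) auto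
  finally have "norm ((of_real a + ?s) / (of_real c - ?s - 1)) * (x / norm (of_real d - ?s - 1)) \<le> ?r n"
    using pd assms(1) by (intro mult_mono frac_le) auto
  from mult_left_mono[OF this norm_ge_zero[of "Barnes_integrand a c d x ?s"]]
  show "norm (Barnes_integrand a c d x (Complex (\<mu> + real (Suc n)) t)) \<le> ?r n * norm (Barnes_integrand a c d x ?s)"
    unfolding eq by (simp only: mult.commute)
qed

text \<open>
  The line is moved to $\Re s = \kappa + n + 1$. The number of poles crossed in each of the two sequences depends
  on $n$ but tends to infinity with $n$, so the two finite residue sums converge to the two full series.
\<close>

lemma line_integral_Barnes_hypergeometric:
  fixes a c d x \<kappa> :: real
  assumes x: "x > 0" and \<kappa>: "- a < \<kappa>" "\<kappa> < c" "\<kappa> < d"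
    and nonres: "c - d \<notin> \<int>" "\<kappa> - c \<notin> \<int>" "\<kappa> - d \<notin> \<int>"
  shows "(LINT t|lborel. Barnes_integrand a c d x (Complex \<kappa> t)) = of_real (2 * pi *
     (Gamma (a + c) * Gamma (d - c) * x powr c * hyp_1F1 (a + c) (1 + c - d) x +
      Gamma (a + d) * Gamma (c - d) * x powr d * hyp_1F1 (a + d) (1 + d - c) x))"
proof -
  define f where "f = Barnes_integrand a c d x"
  define L where "L \<mu> = (LINT t|lborel. f (Complex \<mu> t))" for \<mu>
  \<comment> \<open>The shift by 1 makes already the first new line lie strictly to the right of the old one.\<close>
  define \<mu> where "\<mu> n = \<kappa> + 1 + real n" for n :: nat
  \<comment> \<open>The number of poles $e, e + 1, \<dots>$ to the left of the new line.\<close>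
  define m where "m e n = nat \<lceil>\<mu> n - e\<rceil>" for e n
  define P where "P e n = (\<lambda>k. complex_of_real e + of_nat k) ` {..<m e n}" for e n
  define T where "T e e' k = Gamma (a + e) * Gamma (e' - e) * x powr e *
        (pochhammer (a + e) k / pochhammer (1 + e - e') k * x ^ k / fact k)" for e e' k
  have m: "m e n = 0 \<or> real (m e n) < \<mu> n - e + 1" for e n
    unfolding m_def by linarith
  have m': "\<mu> n < e + real (m e n)" if "\<kappa> - e \<notin> \<int>" for e n
  proof -
    have "\<mu> n \<le> e + real (m e n)" unfolding m_def by linarith
    moreover have "\<mu> n \<noteq> e + real (m e n)"
    proof
      assume "\<mu> n = e + real (m e n)"
      hence "\<kappa> - e = of_nat (m e n) - of_nat (Suc n)" by (simp add: \<mu>_def)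
      thus False using that by (metis Ints_diff Ints_of_nat)
    qed
    ultimately show ?thesis by simp
  qed
  have dc: "d - c \<notin> \<int>" using nonres(1) by (metis Ints_minus minus_diff_eq)
  have disj: "P c n \<inter> P d n = {}" for n
  proof -
    have "complex_of_real c + of_nat k \<noteq> of_real d + of_nat l" for k l
    proof
      assume "complex_of_real c + of_nat k = of_real d + of_nat l"
      hence "Re (complex_of_real c + of_nat k) = Re (of_real d + of_nat l)" by simp
      hence "c - d = of_nat l - of_nat k" by simp
      thus False using nonres(1) by (metis Ints_diff Ints_of_nat)
    qed
    thus ?thesis by (auto simp: P_def)
  qed
  have shift: "integrable lborel (\<lambda>t. f (Complex (\<mu> n) t))"
    "L (\<mu> n) - L \<kappa> = 2 * of_real pi * (\<Sum>p\<in>P c n \<union> P d n. residue f p)" for n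
  proof -
    \<comment> \<open>The real part of the first pole that is not crossed.\<close>
    define b where "b = min (c + real (m c n)) (d + real (m d n))"
    have 4: "- a < \<kappa>" "\<kappa> < \<mu> n" "\<mu> n < b" "finite (P c n \<union> P d n)"
      using \<kappa> m' nonres by (auto simp: b_def \<mu>_def P_def)
    have "\<kappa> < Re p \<and> Re p < \<mu> n" if "p \<in> P e n" "\<kappa> < e" for p e
    proof -
      obtain k where k: "k < m e n" "p = of_real e + of_nat k" using \<open>p \<in> P e n\<close> by (auto simp: P_def)
      have "real k \<le> real (m e n) - 1" using k by linarith
      thus ?thesis using k m[of e n] \<open>\<kappa> < e\<close> by auto
    qed
    hence 3: "\<kappa> < Re p \<and> Re p < \<mu> n" if "p \<in> P c n \<union> P d n" for p
      using that \<kappa> by auto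
    have 2: "f holomorphic_on {z. - a < Re z \<and> Re z < b} - (P c n \<union> P d n)"
    proof -
      have "complex_of_real e - z \<notin> \<int>\<^sub>\<le>\<^sub>0" if "Re z < e + real (m e n)" "z \<notin> P e n" for z e
        using that by (force simp: nonpos_Int_of_real_minus_iff P_def image_iff)
      moreover have "of_real a + z \<notin> \<int>\<^sub>\<le>\<^sub>0" if "- a < Re z" for z
        using that by (auto elim!: nonpos_Ints_cases simp: complex_eq_iff)
      ultimately show ?thesis
        unfolding f_def Barnes_integrand_def using x by (intro holomorphic_intros) (auto simp: b_def)
    qed
    obtain C where 1: "\<And>z. \<kappa> \<le> Re z \<Longrightarrow> Re z \<le> \<mu> n \<Longrightarrow> \<bar>Im z\<bar> \<ge> 1 \<Longrightarrow> norm (f z) \<le> C / (Im z)\<^sup>2"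
      using norm_Barnes_integrand_decay[OF x, of \<kappa> "\<mu> n" a c d] unfolding f_def by blast
    show "integrable lborel (\<lambda>t. f (Complex (\<mu> n) t))"
      "L (\<mu> n) - L \<kappa> = 2 * of_real pi * (\<Sum>p\<in>P c n \<union> P d n. residue f p)"
      unfolding L_def by (rule line_integral_difference_residues(2,3)[OF 4 3 2 1]; assumption)+
  qed
  have "(\<lambda>n. L (\<mu> n)) \<longlonglongrightarrow> 0"
  proof -
    have "(\<kappa> + 1) - e \<notin> \<int>" if "\<kappa> - e \<notin> \<int>" for e
    proof
      assume "(\<kappa> + 1) - e \<in> \<int>"
      hence "(\<kappa> + 1) - e - 1 \<in> \<int>" by (rule Ints_diff) auto
      thus False using that by simp
    qed
    thus ?thesis
      using line_integral_Barnes_tendsto_0[of x a "\<kappa> + 1" c d] shift(1) \<kappa> x nonres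
      by (simp add: L_def \<mu>_def f_def)
  qed
  moreover have "L (\<mu> n) = L \<kappa> - 2 * of_real pi * of_real ((\<Sum>k<m c n. T c d k) + (\<Sum>k<m d n. T d c k))" for n
  proof -
    have inj: "inj_on (\<lambda>k. complex_of_real e + of_nat k) A" for e A by (auto intro: inj_onI)
    have rc: "residue f (of_real c + of_nat k) = - of_real (T c d k)" for k
      unfolding f_def T_def by (rule residue_Barnes_integrand) (use \<kappa> nonres x in auto)
    have rd: "residue f (of_real d + of_nat k) = - of_real (T d c k)" for k
      unfolding f_def T_def Barnes_integrand_commute[of a c]
      by (rule residue_Barnes_integrand) (use \<kappa> dc x in auto)
    have "(\<Sum>p\<in>P c n. residue f p) = - of_real (\<Sum>k<m c n. T c d k)"
      "(\<Sum>p\<in>P d n. residue f p) = - of_real (\<Sum>k<m d n. T d c k)"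
      unfolding P_def by (simp_all add: sum.reindex[OF inj] rc rd sum_negf)
    moreover have "(\<Sum>p\<in>P c n \<union> P d n. residue f p) = (\<Sum>p\<in>P c n. residue f p) + (\<Sum>p\<in>P d n. residue f p)"
      by (rule sum.union_disjoint) (use disj in \<open>auto simp: P_def\<close>)
    ultimately have e: "(\<Sum>p\<in>P c n \<union> P d n. residue f p) =
        - of_real ((\<Sum>k<m c n. T c d k) + (\<Sum>k<m d n. T d c k))" by simp
    have "L (\<mu> n) = L \<kappa> + 2 * of_real pi * (\<Sum>p\<in>P c n \<union> P d n. residue f p)"
      using shift(2)[of n] by (simp add: algebra_simps)
    thus ?thesis unfolding e by (simp only: mult_minus_right diff_conv_add_uminus)
  qed
  moreover have "(\<lambda>n. L \<kappa> - 2 * of_real pi * of_real ((\<Sum>k<m c n. T c d k) + (\<Sum>k<m d n. T d c k)))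
     \<longlonglongrightarrow> L \<kappa> - 2 * of_real pi * of_real (
        Gamma (a + c) * Gamma (d - c) * x powr c * hyp_1F1 (a + c) (1 + c - d) x +
        Gamma (a + d) * Gamma (c - d) * x powr d * hyp_1F1 (a + d) (1 + d - c) x)"
  proof -
    have lim: "(\<lambda>n. \<Sum>k<m e n. T e e' k) \<longlonglongrightarrow>
        Gamma (a + e) * Gamma (e' - e) * x powr e * hyp_1F1 (a + e) (1 + e - e') x" if "e - e' \<notin> \<int>" for e e'
    proof -
      have "1 + e - e' \<notin> \<int>\<^sub>\<le>\<^sub>0"
      proof
        assume h: "1 + e - e' \<in> \<int>\<^sub>\<le>\<^sub>0"
        have "1 + e - e' - 1 \<in> \<int>" by (rule Ints_diff[OF nonpos_Ints_Int[OF h]]) simp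
        thus False using that by simp
      qed
      hence "T e e' sums (Gamma (a + e) * Gamma (e' - e) * x powr e * hyp_1F1 (a + e) (1 + e - e') x)"
        unfolding T_def by (intro sums_mult sums_hyp_1F1)
      moreover have "filterlim (m e) at_top sequentially"
        unfolding filterlim_at_top
      proof
        fix Z :: nat
        show "eventually (\<lambda>n. Z \<le> m e n) sequentially"
          using eventually_ge_at_top[of "nat \<lceil>real Z + e - \<kappa>\<rceil>"]
        proof eventually_elim
          case (elim n)
          hence "real Z \<le> \<mu> n - e" unfolding \<mu>_def by linarith
          thus ?case unfolding m_def by linarith
        qed
      qed
      ultimately show ?thesis
        unfolding sums_def by (rule filterlim_compose)
    qed
    show ?thesis by (intro tendsto_intros lim nonres dc)
  qed
  ultimately have "L \<kappa> - 2 * of_real pi * of_real (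
        Gamma (a + c) * Gamma (d - c) * x powr c * hyp_1F1 (a + c) (1 + c - d) x +
        Gamma (a + d) * Gamma (c - d) * x powr d * hyp_1F1 (a + d) (1 + d - c) x) = 0"
    using LIMSEQ_unique by (simp only:) blast
  thus ?thesis by (simp add: L_def f_def algebra_simps)
qed

section \<open>The Meijer G-function\<close>

lemma is_pole_Gamma_comp_iff:
  "is_pole (\<lambda>s. Gamma (b + s)) s \<longleftrightarrow> b + s \<in> \<int>\<^sub>\<le>\<^sub>0"
  "is_pole (\<lambda>s. Gamma (b - s)) s \<longleftrightarrow> b - s \<in> \<int>\<^sub>\<le>\<^sub>0" for b s :: complex
proof -
  have "is_pole (\<lambda>s. Gamma (g s)) s \<longleftrightarrow> g s \<in> \<int>\<^sub>\<le>\<^sub>0"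
    if "isCont g s" "\<And>w. w \<noteq> s \<Longrightarrow> g w \<noteq> g s" for g
  proof
    assume "g s \<in> \<int>\<^sub>\<le>\<^sub>0"
    then obtain n where n: "g s = - of_nat n" by (auto elim: nonpos_Ints_cases')
    have "filterlim g (at (- of_nat n)) (at s)"
      using that n by (intro filterlim_atI) (auto simp: isCont_def eventually_at_filter)
    thus "is_pole (\<lambda>s. Gamma (g s)) s"
      unfolding is_pole_def by (rule filterlim_compose[OF Gamma_poles])
  next
    assume "is_pole (\<lambda>s. Gamma (g s)) s"
    moreover have "isCont (\<lambda>s. Gamma (g s)) s" if "g s \<notin> \<int>\<^sub>\<le>\<^sub>0"
      using that \<open>isCont g s\<close> by (intro isCont_Gamma)
    ultimately show "g s \<in> \<int>\<^sub>\<le>\<^sub>0"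
      unfolding is_pole_def isCont_def
      using not_tendsto_and_filterlim_at_infinity[of "at s"] by (metis at_neq_bot)
  qed
  from this[of "\<lambda>s. b + s"] this[of "\<lambda>s. b - s"]
  show "is_pole (\<lambda>s. Gamma (b + s)) s \<longleftrightarrow> b + s \<in> \<int>\<^sub>\<le>\<^sub>0"
    "is_pole (\<lambda>s. Gamma (b - s)) s \<longleftrightarrow> b - s \<in> \<int>\<^sub>\<le>\<^sub>0"
    by simp_all
qed

lemma meijer_G_separates_iff:
  fixes a c d \<kappa> :: real
  shows "meijer_G_separates 1 2 [of_real (1 - c), of_real (1 - d)] [of_real a] \<kappa> \<longleftrightarrow>
     - a < \<kappa> \<and> \<kappa> < c \<and> \<kappa> < d"
proof -
  have left: "(\<forall>s. is_pole (\<lambda>s. Gamma (complex_of_real a + s)) s \<longrightarrow> Re s < \<kappa>) \<longleftrightarrow> - a < \<kappa>"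
    unfolding is_pole_Gamma_comp_iff
  proof
    assume "\<forall>s. of_real a + s \<in> \<int>\<^sub>\<le>\<^sub>0 \<longrightarrow> Re s < \<kappa>"
    thus "- a < \<kappa>" by (auto dest: spec[of _ "- of_real a"])
  next
    assume "- a < \<kappa>"
    moreover have "Re s \<le> - a" if "of_real a + s \<in> \<int>\<^sub>\<le>\<^sub>0" for s
      using that by (auto elim!: nonpos_Ints_cases simp: complex_eq_iff)
    ultimately show "\<forall>s. of_real a + s \<in> \<int>\<^sub>\<le>\<^sub>0 \<longrightarrow> Re s < \<kappa>" by (meson le_less_trans)
  qed
  have right: "(\<forall>s. is_pole (\<lambda>s. Gamma (complex_of_real e - s)) s \<longrightarrow> Re s > \<kappa>) \<longleftrightarrow> \<kappa> < e" for e
    unfolding is_pole_Gamma_comp_iff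
  proof
    assume "\<forall>s. of_real e - s \<in> \<int>\<^sub>\<le>\<^sub>0 \<longrightarrow> Re s > \<kappa>"
    thus "\<kappa> < e" by (auto dest: spec[of _ "of_real e"])
  next
    assume "\<kappa> < e"
    moreover have "Re s \<ge> e" if "of_real e - s \<in> \<int>\<^sub>\<le>\<^sub>0" for s
      using that by (auto simp: nonpos_Int_of_real_minus_iff)
    ultimately show "\<forall>s. of_real e - s \<in> \<int>\<^sub>\<le>\<^sub>0 \<longrightarrow> Re s > \<kappa>" by (meson less_le_trans)
  qed
  have All: "(\<forall>j<2. Q j) \<longleftrightarrow> Q 0 \<and> Q (1::nat)" for Q by (auto simp: less_2_cases_iff)
  show ?thesis
    unfolding meijer_G_separates_def All using left right[of c] right[of d] by simp
qed

lemma meijer_G_integrand_eq_Barnes: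
  fixes a c d y :: real
  assumes "y > 0"
  shows "meijer_G_integrand 1 2 [of_real (1 - c), of_real (1 - d)] [of_real a] y s = Barnes_integrand a c d (1 / y) s"
proof -
  have "complex_of_real y powr (- s) = of_real (1 / y) powr s"
    using assms by (simp add: powr_def Ln_of_real[of y] Ln_of_real[of "1 / y"] ln_div del: of_real_divide)
  thus ?thesis
    by (simp add: meijer_G_integrand_def Barnes_integrand_def numeral_2_eq_2)
qed

lemma has_meijer_G_Barnes:
  fixes a c d y :: real
  assumes "- a < c" "- a < d" "y > 0"
  shows "has_meijer_G 1 2 [of_real (1 - c), of_real (1 - d)] [of_real a] y
    (of_real (Gamma (a + c) * (1 / y) powr d *
       (LINT v:{0<..}|lborel. v powr (a + d - 1) * (1 + v) powr (- (a + c)) * exp (- (1 / y * v)))))"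
    (is "has_meijer_G 1 2 ?as ?bs y (of_real ?w)")
  unfolding has_meijer_G_def meijer_G_separates_iff
proof (intro conjI allI impI)
  show "\<exists>\<kappa>. - a < \<kappa> \<and> \<kappa> < c \<and> \<kappa> < d"
    using dense[of "- a" "min c d"] assms by auto
next
  fix \<kappa> assume "- a < \<kappa> \<and> \<kappa> < c \<and> \<kappa> < d"
  hence \<kappa>: "- a < \<kappa>" "\<kappa> < c" "\<kappa> < d" by auto
  have x: "1 / y > 0" using assms by simp
  note line = line_integral_Barnes_integrand[OF \<kappa> x]
  have "((\<lambda>t. Barnes_integrand a c d (1 / y) (Complex \<kappa> t) * \<i>) has_integral
      (LINT t|lborel. Barnes_integrand a c d (1 / y) (Complex \<kappa> t)) * \<i>) UNIV"
    by (intro has_integral_mult_left has_integral_integral_lborel line)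
  hence "((\<lambda>t. meijer_G_integrand 1 2 ?as ?bs y (Complex \<kappa> t) * \<i>) has_integral (of_real (2 * pi * ?w) * \<i>)) UNIV"
    by (simp only: meijer_G_integrand_eq_Barnes[OF assms(3)] line(2) mult.assoc)
  moreover have "of_real ?w = 1 / (2 * of_real pi * \<i>) * (of_real (2 * pi * ?w) * \<i>)"
    by (simp add: field_simps)
  ultimately show "\<exists>I. ((\<lambda>t. meijer_G_integrand 1 2 ?as ?bs y (Complex \<kappa> t) * \<i>) has_integral I) UNIV \<and>
      of_real ?w = 1 / (2 * of_real pi * \<i>) * I" by blast
qed auto

text \<open>
  The resonant abscissas form a countable set, so they cannot fill an interval.
\<close>

lemma Barnes_nonresonant_line:
  fixes a c d :: real
  assumes "- a < c" "- a < d"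
  obtains \<kappa> where "- a < \<kappa>" "\<kappa> < c" "\<kappa> < d" "\<kappa> - c \<notin> \<int>" "\<kappa> - d \<notin> \<int>"
proof -
  have "countable ((\<lambda>z. z + e) ` (\<int> :: real set))" for e
    by (intro countable_image countable_int)
  hence "countable ((\<lambda>z. z + c) ` \<int> \<union> (\<lambda>z. z + d) ` (\<int> :: real set))" by auto
  moreover have "uncountable {- a<..<min c d}" using assms by (simp add: uncountable_open_interval)
  ultimately have "\<not> {- a<..<min c d} \<subseteq> (\<lambda>z. z + c) ` \<int> \<union> (\<lambda>z. z + d) ` \<int>"
    by (meson countable_subset)
  then obtain \<kappa> where \<kappa>: "\<kappa> \<in> {- a<..<min c d}" "\<kappa> \<notin> (\<lambda>z. z + c) ` \<int>" "\<kappa> \<notin> (\<lambda>z. z + d) ` \<int>"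
    unfolding subset_eq by blast
  have "\<kappa> - e \<notin> \<int>" if "\<kappa> \<notin> (\<lambda>z. z + e) ` \<int>" for e
    using that by (metis diff_add_cancel image_eqI)
  with \<kappa> show ?thesis by (intro that[of \<kappa>]) auto
qed

text \<open>
  The Laplace-type integral gives the value for every separating line at once; comparing it with the residue
  series on one non-resonant line proves the hypergeometric formula.
\<close>

theorem theorem3p2:
  fixes \<alpha>\<^sub>1 \<alpha>\<^sub>2 \<beta>\<^sub>2 a\<^sub>1 u :: real
  assumes "\<alpha>\<^sub>1 > -1" and "\<alpha>\<^sub>2 > -1" and "\<beta>\<^sub>2 > 0" and "a\<^sub>1 > 0" and "u > 0"
  shows
    "(\<exists>w. has_meijer_G 1 2 [of_real (- \<beta>\<^sub>2), of_real (- 1 - \<alpha>\<^sub>1)] [of_real \<alpha>\<^sub>2] (u / a\<^sub>1) w) \<and>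
     (\<lambda>v. v powr (\<alpha>\<^sub>1 + \<alpha>\<^sub>2 + 1) * (1 + v) powr (- (1 + \<alpha>\<^sub>2 + \<beta>\<^sub>2)) * exp (- a\<^sub>1 * v / u))
       integrable_on {0<..} \<and>
     (\<lambda>v. v powr (\<alpha>\<^sub>1 + \<alpha>\<^sub>2 + 1) * (1 + u * v) powr (- (1 + \<alpha>\<^sub>2 + \<beta>\<^sub>2)) * exp (- a\<^sub>1 * v))
       integrable_on {0<..} \<and>
     meijer_G 1 2 [of_real (- \<beta>\<^sub>2), of_real (- 1 - \<alpha>\<^sub>1)] [of_real \<alpha>\<^sub>2] (u / a\<^sub>1) =
       of_real (a\<^sub>1 powr (\<alpha>\<^sub>1 + 2) * Gamma (\<alpha>\<^sub>2 + \<beta>\<^sub>2 + 1) * u powr (- \<alpha>\<^sub>1 - 2) *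
         integral {0<..} (\<lambda>v. v powr (\<alpha>\<^sub>1 + \<alpha>\<^sub>2 + 1) * (1 + v) powr (- (1 + \<alpha>\<^sub>2 + \<beta>\<^sub>2)) *
           exp (- a\<^sub>1 * v / u))) \<and>
     meijer_G 1 2 [of_real (- \<beta>\<^sub>2), of_real (- 1 - \<alpha>\<^sub>1)] [of_real \<alpha>\<^sub>2] (u / a\<^sub>1) =
       of_real (a\<^sub>1 powr (\<alpha>\<^sub>1 + 2) * Gamma (\<alpha>\<^sub>2 + \<beta>\<^sub>2 + 1) * u powr \<alpha>\<^sub>2 *
         integral {0<..} (\<lambda>v. v powr (\<alpha>\<^sub>1 + \<alpha>\<^sub>2 + 1) * (1 + u * v) powr (- (1 + \<alpha>\<^sub>2 + \<beta>\<^sub>2)) *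
           exp (- a\<^sub>1 * v))) \<and>
     ((\<forall>\<nu>::nat. \<beta>\<^sub>2 - \<alpha>\<^sub>1 - 1 \<noteq> real \<nu> \<and> \<beta>\<^sub>2 - \<alpha>\<^sub>1 - 1 \<noteq> - real \<nu>) \<longrightarrow>
      meijer_G 1 2 [of_real (- \<beta>\<^sub>2), of_real (- 1 - \<alpha>\<^sub>1)] [of_real \<alpha>\<^sub>2] (u / a\<^sub>1) =
        of_real (Gamma (\<alpha>\<^sub>2 + \<beta>\<^sub>2 + 1) * Gamma (1 + \<alpha>\<^sub>1 - \<beta>\<^sub>2) * (a\<^sub>1 / u) powr (1 + \<beta>\<^sub>2) *
            hyp_1F1 (1 + \<alpha>\<^sub>2 + \<beta>\<^sub>2) (\<beta>\<^sub>2 - \<alpha>\<^sub>1) (a\<^sub>1 / u)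
          + Gamma (2 + \<alpha>\<^sub>1 + \<alpha>\<^sub>2) * Gamma (\<beta>\<^sub>2 - \<alpha>\<^sub>1 - 1) * (a\<^sub>1 / u) powr (2 + \<alpha>\<^sub>1) *
            hyp_1F1 (2 + \<alpha>\<^sub>1 + \<alpha>\<^sub>2) (2 + \<alpha>\<^sub>1 - \<beta>\<^sub>2) (a\<^sub>1 / u)))"
proof -
  define c d x where "c = 1 + \<beta>\<^sub>2" and "d = 2 + \<alpha>\<^sub>1" and "x = a\<^sub>1 / u"
  define p r where "p = \<alpha>\<^sub>1 + \<alpha>\<^sub>2 + 1" and "r = 1 + \<alpha>\<^sub>2 + \<beta>\<^sub>2"
  have par: "- \<beta>\<^sub>2 = 1 - c" "- 1 - \<alpha>\<^sub>1 = 1 - d" by (simp_all add: c_def d_def)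
  have order: "- \<alpha>\<^sub>2 < c" "- \<alpha>\<^sub>2 < d" and x: "x > 0" "1 / (u / a\<^sub>1) = x" and y: "u / a\<^sub>1 > 0"
    using assms by (auto simp: c_def d_def x_def)
  have pr: "p > -1" "r \<ge> 0" using assms by (auto simp: p_def r_def)
  let ?I1 = "\<lambda>v. v powr p * (1 + v) powr (- r) * exp (- a\<^sub>1 * v / u)"
  let ?I2 = "\<lambda>v. v powr p * (1 + u * v) powr (- r) * exp (- a\<^sub>1 * v)"
  have int1: "set_integrable lborel {0<..} ?I1"
    using set_integrable_powr_exp[of p x r 1] pr x by (simp add: x_def)
  have int2: "set_integrable lborel {0<..} ?I2"
    using set_integrable_powr_exp[of p a\<^sub>1 r u] pr assms by simp
  note I1 = set_borel_integral_eq_integral[OF int1] and I2 = set_borel_integral_eq_integral[OF int2]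
  let ?w = "Gamma (\<alpha>\<^sub>2 + c) * x powr d * integral {0<..} ?I1"
  have G: "has_meijer_G 1 2 [of_real (1 - c), of_real (1 - d)] [of_real \<alpha>\<^sub>2] (u / a\<^sub>1) (of_real ?w)"
  proof -
    have "\<alpha>\<^sub>2 + d - 1 = p" "\<alpha>\<^sub>2 + c = r" by (simp_all add: p_def r_def c_def d_def)
    moreover have "- (x * v) = - a\<^sub>1 * v / u" for v by (simp add: x_def)
    ultimately show ?thesis
      using has_meijer_G_Barnes[OF order y] unfolding x(2) by (simp only: I1(2))
  qed
  note G_eq = meijer_G_eqI[OF G]
  have w1: "?w = a\<^sub>1 powr (\<alpha>\<^sub>1 + 2) * Gamma (\<alpha>\<^sub>2 + \<beta>\<^sub>2 + 1) * u powr (- \<alpha>\<^sub>1 - 2) * integral {0<..} ?I1"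
  proof -
    have "x powr d = a\<^sub>1 powr d * u powr (- d)"
      using assms by (simp add: x_def powr_divide powr_minus) (simp add: divide_inverse)
    moreover have "\<alpha>\<^sub>1 + 2 = d" "- \<alpha>\<^sub>1 - 2 = - d" by (simp_all add: d_def)
    ultimately have e: "x powr d = a\<^sub>1 powr (\<alpha>\<^sub>1 + 2) * u powr (- \<alpha>\<^sub>1 - 2)"
      by (simp only:)
    have ac: "\<alpha>\<^sub>2 + c = \<alpha>\<^sub>2 + \<beta>\<^sub>2 + 1" by (simp add: c_def)
    show ?thesis unfolding e ac by simp
  qed
  have w2: "u powr (- \<alpha>\<^sub>1 - 2) * integral {0<..} ?I1 = u powr \<alpha>\<^sub>2 * integral {0<..} ?I2"
  proof -
    have "integral {0<..} ?I1 = u powr (p + 1) * integral {0<..} ?I2"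
      using set_integral_rescale_powr[OF assms(5), of p r a\<^sub>1] unfolding I1(2)[symmetric] I2(2)[symmetric]
      by simp
    moreover have "u powr (- \<alpha>\<^sub>1 - 2) * u powr (p + 1) = u powr \<alpha>\<^sub>2"
      by (simp add: powr_add[symmetric] p_def)
    ultimately show ?thesis by (simp flip: mult.assoc)
  qed
  have w2': "?w = a\<^sub>1 powr (\<alpha>\<^sub>1 + 2) * Gamma (\<alpha>\<^sub>2 + \<beta>\<^sub>2 + 1) * u powr \<alpha>\<^sub>2 * integral {0<..} ?I2"
  proof -
    have "?w = a\<^sub>1 powr (\<alpha>\<^sub>1 + 2) * Gamma (\<alpha>\<^sub>2 + \<beta>\<^sub>2 + 1) * (u powr (- \<alpha>\<^sub>1 - 2) * integral {0<..} ?I1)"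
      unfolding w1 by (rule mult.assoc)
    thus ?thesis unfolding w2 by (simp only: mult.assoc[symmetric])
  qed
  have w3: "complex_of_real ?w = of_real (Gamma (\<alpha>\<^sub>2 + c) * Gamma (d - c) * x powr c * hyp_1F1 (\<alpha>\<^sub>2 + c) (1 + c - d) x +
      Gamma (\<alpha>\<^sub>2 + d) * Gamma (c - d) * x powr d * hyp_1F1 (\<alpha>\<^sub>2 + d) (1 + d - c) x)"
    (is "_ = complex_of_real ?h")
    if "c - d \<notin> \<int>"
  proof -
    obtain \<kappa> where \<kappa>: "- \<alpha>\<^sub>2 < \<kappa>" "\<kappa> < c" "\<kappa> < d" "\<kappa> - c \<notin> \<int>" "\<kappa> - d \<notin> \<int>"
      using Barnes_nonresonant_line[OF order] by blast
    have "meijer_G_separates 1 2 [of_real (1 - c), of_real (1 - d)] [of_real \<alpha>\<^sub>2] \<kappa>"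
      using \<kappa> by (simp only: meijer_G_separates_iff)
    with G obtain I where I: "((\<lambda>t. meijer_G_integrand 1 2 [of_real (1 - c), of_real (1 - d)] [of_real \<alpha>\<^sub>2] (u / a\<^sub>1) (Complex \<kappa> t) * \<i>) has_integral I) UNIV"
      "of_real ?w = 1 / (2 * of_real pi * \<i>) * I"
      unfolding has_meijer_G_def by blast
    have "((\<lambda>t. Barnes_integrand \<alpha>\<^sub>2 c d x (Complex \<kappa> t) * \<i>) has_integral
      (LINT t|lborel. Barnes_integrand \<alpha>\<^sub>2 c d x (Complex \<kappa> t)) * \<i>) UNIV"
      by (intro has_integral_mult_left has_integral_integral_lborel line_integral_Barnes_integrand(1) \<kappa> x)
    with I(1) have "I = (LINT t|lborel. Barnes_integrand \<alpha>\<^sub>2 c d x (Complex \<kappa> t)) * \<i>"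
      unfolding meijer_G_integrand_eq_Barnes[OF y] x(2) by (rule has_integral_unique)
    also have "(LINT t|lborel. Barnes_integrand \<alpha>\<^sub>2 c d x (Complex \<kappa> t)) = of_real (2 * pi * ?h)"
      by (rule line_integral_Barnes_hypergeometric) (use \<kappa> x that in auto)
    finally show ?thesis using I(2) by simp
  qed
  have nonint: "c - d \<notin> \<int>" if "\<forall>\<nu>::nat. \<beta>\<^sub>2 - \<alpha>\<^sub>1 - 1 \<noteq> real \<nu> \<and> \<beta>\<^sub>2 - \<alpha>\<^sub>1 - 1 \<noteq> - real \<nu>"
  proof
    assume "c - d \<in> \<int>"
    then obtain m where "c - d = of_int m" by (elim Ints_cases)
    hence "\<beta>\<^sub>2 - \<alpha>\<^sub>1 - 1 = of_int m" by (simp add: c_def d_def)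
    thus False using that by (cases m rule: int_cases2) auto
  qed
  have hyp_par: "\<alpha>\<^sub>2 + c = \<alpha>\<^sub>2 + \<beta>\<^sub>2 + 1" "\<alpha>\<^sub>2 + c = 1 + \<alpha>\<^sub>2 + \<beta>\<^sub>2" "d - c = 1 + \<alpha>\<^sub>1 - \<beta>\<^sub>2" "1 + c - d = \<beta>\<^sub>2 - \<alpha>\<^sub>1"
    "\<alpha>\<^sub>2 + d = 2 + \<alpha>\<^sub>1 + \<alpha>\<^sub>2" "c - d = \<beta>\<^sub>2 - \<alpha>\<^sub>1 - 1" "1 + d - c = 2 + \<alpha>\<^sub>1 - \<beta>\<^sub>2"
    by (simp_all add: c_def d_def)
  show ?thesis
    unfolding par G_eq p_def[symmetric] r_def[symmetric]
  proof (intro conjI impI)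
    show "\<exists>w. has_meijer_G 1 2 [of_real (1 - c), of_real (1 - d)] [of_real \<alpha>\<^sub>2] (u / a\<^sub>1) w"
      using G by blast
    show "?I1 integrable_on {0<..}" by (rule I1)
    show "?I2 integrable_on {0<..}" by (rule I2)
    show "complex_of_real ?w = of_real (a\<^sub>1 powr (\<alpha>\<^sub>1 + 2) * Gamma (\<alpha>\<^sub>2 + \<beta>\<^sub>2 + 1) * u powr (- \<alpha>\<^sub>1 - 2) * integral {0<..} ?I1)"
      by (simp only: w1)
    show "complex_of_real ?w = of_real (a\<^sub>1 powr (\<alpha>\<^sub>1 + 2) * Gamma (\<alpha>\<^sub>2 + \<beta>\<^sub>2 + 1) * u powr \<alpha>\<^sub>2 * integral {0<..} ?I2)"
      by (simp only: w2')
    assume "\<forall>\<nu>::nat. \<beta>\<^sub>2 - \<alpha>\<^sub>1 - 1 \<noteq> real \<nu> \<and> \<beta>\<^sub>2 - \<alpha>\<^sub>1 - 1 \<noteq> - real \<nu>"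
    from w3[OF nonint[OF this]]
    show "complex_of_real ?w = of_real (Gamma (\<alpha>\<^sub>2 + \<beta>\<^sub>2 + 1) * Gamma (1 + \<alpha>\<^sub>1 - \<beta>\<^sub>2) * (a\<^sub>1 / u) powr (1 + \<beta>\<^sub>2) *
            hyp_1F1 r (\<beta>\<^sub>2 - \<alpha>\<^sub>1) (a\<^sub>1 / u)
          + Gamma (2 + \<alpha>\<^sub>1 + \<alpha>\<^sub>2) * Gamma (\<beta>\<^sub>2 - \<alpha>\<^sub>1 - 1) * (a\<^sub>1 / u) powr (2 + \<alpha>\<^sub>1) *
            hyp_1F1 (2 + \<alpha>\<^sub>1 + \<alpha>\<^sub>2) (2 + \<alpha>\<^sub>1 - \<beta>\<^sub>2) (a\<^sub>1 / u))"
      unfolding hyp_par(3-) x_def r_def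
      by (simp only: c_def d_def add_ac)
  qed
qed

end
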